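(* Let $K$ be a field, $n\ge 2$ an integer, $S=K[x_1,\ldots,x_n]$, and for $1\le m<n$ let $J_{n,m}\subset S$ be the ideal generated by the products of $m$ cyclically consecutive variables. Let $t\ge 1$ denote an integer. Then: (1) $\operatorname{sdepth}(S/J_{n,n-1}^t)=\operatorname{depth}(S/J_{n,n-1}^t)=0$ for all $n\geq 2$ and $t\geq n-1$. (2) If $n\geq 3$ is odd, then $\operatorname{sdepth}(S/J_{n,n-2}^t)=\operatorname{depth}(S/J_{n,n-2}^t)=0$ for all $t\geq \frac{n-1}{2}$. (3) If $n\geq 5$ is odd, then $\operatorname{sdepth}(S/J_{n,n-2}^t)>0$ and $\operatorname{depth}(S/J_{n,n-2}^t)>0$ for all $1\le t<\frac{n-1}{2}$. (4) If $n\geq 5$ is even, then $\operatorname{sdepth}(S/J_{n,n-2}^t)>0$ and $\operatorname{depth}(S/J_{n,n-2}^t)>0$ for all $t\geq 1$. (5) If $n\geq 5$ is even, then $\frac{n}{2}\geq \operatorname{sdepth}(S/J_{n,n-2}^t)\geq \operatorname{depth}(S/J_{n,n-2}^t)=1$ for all $t\geq n-1$.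
   Context: $J_{n,m}$ is the $m$-path ideal of the cycle graph on $n$ vertices: $J_{n,m}=(x_ix_{i+1}\cdots x_{i+m-1} : 1\le i\le n)\subset S$, where indices are read modulo $n$ in $\{1,\ldots,n\}$. $\operatorname{depth}$ is the depth of a finitely generated graded $S$-module with respect to the maximal ideal $(x_1,\ldots,x_n)$. For a monomial ideal $I\subsetneq S$, a Stanley decomposition of $M=S/I$ is a decomposition $\mathcal D: M=\bigoplus_{i=1}^r m_iK[Z_i]$ as a direct sum of $\mathbb Z^n$-graded $K$-vector spaces, where the $m_i\in S$ are monomials, $Z_i\subset\{x_1,\ldots,x_n\}$, and $m_iK[Z_i]$ denotes the $K$-span in $S/I$ of the classes of $m_iw$, $w$ a monomial in $Z_i$, these classes being linearly independent. Put $\operatorname{sdepth}(\mathcal D)=\min_i|Z_i|$; the Stanley depth $\operatorname{sdepth}(M)$ is the maximum of $\operatorname{sdepth}(\mathcal D)$ over all Stanley decompositions $\mathcal D$ of $M$. *)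

theory Defs
  imports
    "HOL-Algebra.Ideal_Product"
    "HOL-Algebra.QuotRing"
    "HOL-Algebra.Module"
    "HOL-Library.Poly_Mapping"
    "HOL-Library.Extended_Nat"
begin

section \<open>Depth of a module\<close>

definition ideal_smult :: "('a, 'b) ring_scheme \<Rightarrow> ('a, 'c, 'd) module_scheme \<Rightarrow> 'a set \<Rightarrow> 'c set"
  where "ideal_smult R M I =
    \<Inter>{N. submodule N R M \<and> {a \<odot>\<^bsub>M\<^esub> u | a u. a \<in> I \<and> u \<in> carrier M} \<subseteq> N}"

text \<open>
  A sequence \<open>a\<^sub>1, \<dots>, a\<^sub>r\<close> is \<open>M\<close>-regular if \<open>a\<^sub>i\<close> is a non-zero-divisor on
  \<open>M / (a\<^sub>1, \<dots>, a\<^sub>i\<^sub>-\<^sub>1) M\<close> for all \<open>i\<close> and \<open>(a\<^sub>1, \<dots>, a\<^sub>r) M \<noteq> M\<close>. The first condition is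
  expressed on representatives. List indices start at 0, so the elements preceding
  \<open>xs ! i\<close> are those of \<open>take i xs\<close>.
\<close>

definition regular_sequence ::
  "('a, 'b) ring_scheme \<Rightarrow> ('a, 'c, 'd) module_scheme \<Rightarrow> 'a list \<Rightarrow> bool"
  where "regular_sequence R M xs \<longleftrightarrow>
    set xs \<subseteq> carrier R \<and>
    (\<forall>i < length xs. \<forall>u \<in> carrier M.
       xs ! i \<odot>\<^bsub>M\<^esub> u \<in> ideal_smult R M (Idl\<^bsub>R\<^esub> (set (take i xs))) \<longrightarrow>
       u \<in> ideal_smult R M (Idl\<^bsub>R\<^esub> (set (take i xs)))) \<and>
    ideal_smult R M (Idl\<^bsub>R\<^esub> (set xs)) \<noteq> carrier M"

text \<open>The supremum is taken in \<^typ>\<open>enat\<close>, where it does not depend on a bound for the lengths.\<close>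

definition depth :: "('a, 'b) ring_scheme \<Rightarrow> 'a set \<Rightarrow> ('a, 'c, 'd) module_scheme \<Rightarrow> enat"
  where "depth R I M = (SUP xs \<in> {xs. set xs \<subseteq> I \<and> regular_sequence R M xs}. enat (length xs))"

text \<open>The residue class ring \<open>R/I\<close> as an \<open>R\<close>-module.\<close>

definition quot_module :: "('a, 'b) ring_scheme \<Rightarrow> 'a set \<Rightarrow> ('a, 'a set) module"
  where "quot_module R I =
    \<lparr> carrier = carrier (R Quot I), mult = mult (R Quot I), one = \<one>\<^bsub>R Quot I\<^esub>,
      zero = \<zero>\<^bsub>R Quot I\<^esub>, add = add (R Quot I),
      smult = (\<lambda>a X. (I +>\<^bsub>R\<^esub> a) \<otimes>\<^bsub>R Quot I\<^esub> X) \<rparr>"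

definition internal_direct_sum :: "('a, 'b) ring_scheme \<Rightarrow> nat \<Rightarrow> (nat \<Rightarrow> 'a set) \<Rightarrow> bool"
  where "internal_direct_sum M r V \<longleftrightarrow>
    (\<forall>i<r. V i \<subseteq> carrier M) \<and>
    (\<forall>u \<in> carrier M. \<exists>!f. f \<in> (\<Pi>\<^sub>E i\<in>{..<r}. V i) \<and> u = (\<Oplus>\<^bsub>M\<^esub> i\<in>{..<r}. f i))"


section \<open>Polynomial rings\<close>

text \<open>
  The outer mapping sends an exponent vector (finitely supported, indexed by the variables
  \<open>x\<^sub>0, x\<^sub>1, x\<^sub>2, \<dots>\<close>) to its coefficient.
\<close>

type_synonym 'k mpoly = "(nat \<Rightarrow>\<^sub>0 nat) \<Rightarrow>\<^sub>0 'k"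

definition monomial :: "(nat \<Rightarrow>\<^sub>0 nat) \<Rightarrow> 'k::comm_ring_1 mpoly"
  where "monomial a = Poly_Mapping.single a 1"

definition const :: "'k::comm_ring_1 \<Rightarrow> 'k mpoly"
  where "const c = Poly_Mapping.single 0 c"

definition var :: "nat \<Rightarrow> 'k::comm_ring_1 mpoly"
  where "var i = monomial (Poly_Mapping.single i 1)"

definition exponents :: "nat set \<Rightarrow> (nat \<Rightarrow>\<^sub>0 nat) set"
  where "exponents V = {a. Poly_Mapping.keys a \<subseteq> V}"

text \<open>\<open>K[x\<^sub>i : i \<in> V]\<close>\<close>

definition poly_ring :: "nat set \<Rightarrow> 'k::comm_ring_1 mpoly ring"
  where "poly_ring V =
    \<lparr> carrier = {p. Poly_Mapping.keys p \<subseteq> exponents V}, mult = (*), one = 1, zero = 0, add = (+) \<rparr>"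

text \<open>The ring \<open>S = K[x\<^sub>1, \<dots>, x\<^sub>n]\<close> and its ideal \<open>(x\<^sub>1, \<dots>, x\<^sub>n)\<close>.\<close>

abbreviation S_ring :: "nat \<Rightarrow> 'k::comm_ring_1 mpoly ring"
  where "S_ring n \<equiv> poly_ring {1..n}"

definition max_ideal :: "nat \<Rightarrow> 'k::comm_ring_1 mpoly set"
  where "max_ideal n = Idl\<^bsub>S_ring n\<^esub> (var ` {1..n})"

definition depth_quot :: "nat \<Rightarrow> 'k::field mpoly set \<Rightarrow> enat"
  where "depth_quot n I = depth (S_ring n) (max_ideal n) (quot_module (S_ring n) I)"


section \<open>Stanley decompositions\<close>

text \<open>The class in \<open>S/I\<close> of \<open>\<Sum>w\<in>W. c\<^sub>w x\<^sup>m x\<^sup>w\<close>, as a \<open>K\<close>-linear combination of classes of monomials.\<close>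

definition monomial_combination ::
  "nat \<Rightarrow> 'k::field mpoly set \<Rightarrow> (nat \<Rightarrow>\<^sub>0 nat) \<Rightarrow> (nat \<Rightarrow>\<^sub>0 nat) set \<Rightarrow> ((nat \<Rightarrow>\<^sub>0 nat) \<Rightarrow> 'k) \<Rightarrow> 'k mpoly set"
  where "monomial_combination n I m W c =
    (\<Oplus>\<^bsub>quot_module (S_ring n) I\<^esub> w\<in>W.
       const (c w) \<odot>\<^bsub>quot_module (S_ring n) I\<^esub> (I +>\<^bsub>S_ring n\<^esub> (monomial m * monomial w)))"

text \<open>The span \<open>x\<^sup>m K[Z]\<close> in \<open>S/I\<close>, and linear independence of the family spanning it.\<close>

definition stanley_space ::
  "nat \<Rightarrow> 'k::field mpoly set \<Rightarrow> (nat \<Rightarrow>\<^sub>0 nat) \<Rightarrow> nat set \<Rightarrow> 'k mpoly set set"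
  where "stanley_space n I m Z =
    {monomial_combination n I m W c | W c. finite W \<and> W \<subseteq> exponents Z}"

definition stanley_independent ::
  "nat \<Rightarrow> 'k::field mpoly set \<Rightarrow> (nat \<Rightarrow>\<^sub>0 nat) \<Rightarrow> nat set \<Rightarrow> bool"
  where "stanley_independent n I m Z \<longleftrightarrow>
    (\<forall>W c. finite W \<and> W \<subseteq> exponents Z \<and>
       monomial_combination n I m W c = \<zero>\<^bsub>quot_module (S_ring n) I\<^esub> \<longrightarrow> (\<forall>w\<in>W. c w = 0))"

text \<open>
  A decomposition is the list of the pairs \<open>(m\<^sub>i, Z\<^sub>i)\<close>; monomials are given by their exponents
  and sets of variables by their indices. For a monomial ideal \<open>I\<close> the summands are spanned
  by homogeneous elements of the \<open>\<int>\<^sup>n\<close>-graded space \<open>S/I\<close>, so the sum is one of graded spaces.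
\<close>

definition stanley_decomposition ::
  "nat \<Rightarrow> 'k::field mpoly set \<Rightarrow> ((nat \<Rightarrow>\<^sub>0 nat) \<times> nat set) list \<Rightarrow> bool"
  where "stanley_decomposition n I D \<longleftrightarrow>
    (\<forall>(m, Z) \<in> set D. m \<in> exponents {1..n} \<and> Z \<subseteq> {1..n} \<and> stanley_independent n I m Z) \<and>
    internal_direct_sum (quot_module (S_ring n) I) (length D)
      (\<lambda>i. stanley_space n I (fst (D ! i)) (snd (D ! i)))"

definition sdepth_decomposition :: "((nat \<Rightarrow>\<^sub>0 nat) \<times> nat set) list \<Rightarrow> nat"
  where "sdepth_decomposition D = Min ((\<lambda>(m, Z). card Z) ` set D)"

text \<open>
  For \<open>I \<noteq> S\<close> a decomposition is nonempty, so the minimum above is over a nonempty set; the set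
  of values below is bounded by \<open>n\<close>.
\<close>

definition sdepth_quot :: "nat \<Rightarrow> 'k::field mpoly set \<Rightarrow> nat"
  where "sdepth_quot n I = Max {sdepth_decomposition D | D. stanley_decomposition n I D}"


section \<open>Path ideals of cycles\<close>

text \<open>
  The index \<open>i + j\<close>, read modulo \<open>n\<close> in \<open>{1..n}\<close>, is \<open>(i + j - 1) mod n + 1\<close>.
\<close>

definition cycle_path_ideal :: "nat \<Rightarrow> nat \<Rightarrow> 'k::comm_ring_1 mpoly set"
  where "cycle_path_ideal n m =
    Idl\<^bsub>S_ring n\<^esub> ((\<lambda>i. \<Prod>j<m. var ((i + j - 1) mod n + 1)) ` {1..n})"

definition cycle_path_ideal_power :: "nat \<Rightarrow> nat \<Rightarrow> nat \<Rightarrow> 'k::comm_ring_1 mpoly set"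
  where "cycle_path_ideal_power n m t = cycle_path_ideal n m [^]\<^bsub>ideals_set (S_ring n)\<^esub> t"


section \<open>Well-formedness\<close>

lemma poly_ring_cring: "cring (poly_ring V :: 'k::comm_ring_1 mpoly ring)"
proof (rule cringI)
  show "abelian_group (poly_ring V :: 'k mpoly ring)"
  proof (rule abelian_groupI)
    fix x y :: "'k mpoly"
    assume x: "x \<in> carrier (poly_ring V)" and y: "y \<in> carrier (poly_ring V)"
    show "x \<oplus>\<^bsub>poly_ring V\<^esub> y \<in> carrier (poly_ring V)"
      using x y Poly_Mapping.keys_add[of x y] by (auto simp: poly_ring_def)
    have "Poly_Mapping.keys (- x) = Poly_Mapping.keys x" by (auto simp: Poly_Mapping.in_keys_iff)
    with x show "\<exists>z \<in> carrier (poly_ring V). z \<oplus>\<^bsub>poly_ring V\<^esub> x = \<zero>\<^bsub>poly_ring V\<^esub>"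
      by (intro bexI[of _ "- x"]) (auto simp: poly_ring_def)
  qed (auto simp: poly_ring_def algebra_simps)
  show "Group.comm_monoid (poly_ring V :: 'k mpoly ring)"
  proof (rule comm_monoidI)
    fix x y :: "'k mpoly"
    assume x: "x \<in> carrier (poly_ring V)" and y: "y \<in> carrier (poly_ring V)"
    have "a + b \<in> exponents V" if "a \<in> exponents V" "b \<in> exponents V" for a b
      using that Poly_Mapping.keys_add[of a b] by (auto simp: exponents_def)
    then show "x \<otimes>\<^bsub>poly_ring V\<^esub> y \<in> carrier (poly_ring V)"
      using x y Poly_Mapping.keys_mult[of x y] by (fastforce simp: poly_ring_def)
  qed (auto simp: poly_ring_def exponents_def algebra_simps)
qed (auto simp: poly_ring_def algebra_simps)

lemma quot_module_is_module:
  assumes "cring R" "ideal I R"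
  shows "Module.module R (quot_module R I)"
proof -
  interpret R: cring R by fact
  interpret ideal I R by fact
  interpret Q: ring "R Quot I" by (rule quotient_is_ring)
  have hom: "(+>\<^bsub>R\<^esub>) I \<in> ring_hom R (R Quot I)" by (rule rcos_ring_hom)
  show ?thesis
  proof (rule Module.moduleI)
    show "abelian_group (quot_module R I)"
      using Q.a_assoc Q.a_comm Q.add.l_inv_ex
      by (intro abelian_groupI) (auto simp: quot_module_def)
  qed (use R.cring_axioms ring_hom_closed[OF hom] ring_hom_add[OF hom] ring_hom_mult[OF hom]
        ring_hom_one[OF hom] in
      \<open>auto simp: quot_module_def Q.l_distr Q.r_distr Q.m_assoc\<close>)
qed

lemma cycle_path_ideal_is_ideal:
  assumes "n \<ge> 1"
  shows "ideal (cycle_path_ideal n m :: 'k::comm_ring_1 mpoly set) (S_ring n)"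
proof -
  interpret cring "S_ring n :: 'k mpoly ring" by (rule poly_ring_cring)
  have var: "var (k mod n + 1) \<in> carrier (S_ring n :: 'k mpoly ring)" for k
  proof -
    have "k mod n < n" using assms by simp
    then show ?thesis by (simp add: poly_ring_def var_def monomial_def exponents_def)
  qed
  have "(\<Prod>j<m. var ((i + j - 1) mod n + 1)) \<in> carrier (S_ring n :: 'k mpoly ring)" for i
  proof (induction m)
    case 0
    show ?case using one_closed by (simp add: poly_ring_def)
  next
    case (Suc m)
    then show ?case using m_closed[OF Suc var[of "i + m - 1"]] by (simp add: poly_ring_def)
  qed
  then show ?thesis
    unfolding cycle_path_ideal_def by (intro genideal_ideal) auto
qed

lemma cycle_path_ideal_power_is_ideal:
  assumes "n \<ge> 1"
  shows "ideal (cycle_path_ideal_power n m t :: 'k::comm_ring_1 mpoly set) (S_ring n)"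
proof -
  interpret cring "S_ring n :: 'k mpoly ring" by (rule poly_ring_cring)
  interpret I: Group.comm_monoid "ideals_set (S_ring n :: 'k mpoly ring)"
    by (rule ideals_set_is_comm_monoid)
  show ?thesis
    using I.nat_pow_closed[of "cycle_path_ideal n m" t] cycle_path_ideal_is_ideal[OF assms, of m]
    by (simp add: cycle_path_ideal_power_def ideals_set_def)
qed

end

theory Submission
  imports Defs
begin

text \<open>
  Exponents outside of \<open>J\<^sup>t\<close> are described by edge covers: for \<open>m = n - 2\<close> the exponent \<open>a\<close> lies in
  \<open>J\<^sup>t\<close> iff the demands \<open>t - a\<^sub>v\<close> at the vertices of the \<open>n\<close>-cycle can be met by \<open>t\<close> edges with
  multiplicity. A demand that cannot be met is obstructed by a stable set of vertices of weight
  above \<open>t\<close> or, if it is positive everywhere, by its total weight; so it stays obstructed when a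
  suitable vertex is dropped, unless \<open>n\<close> is odd and \<open>t \<ge> (n - 1) / 2\<close>. Dropping a vertex means
  inverting a variable, hence every monomial outside of \<open>J\<^sup>t\<close> survives the inversion of some
  variable. This makes \<open>x\<^sub>1 + \<dots> + x\<^sub>n\<close> a nonzerodivisor and allows a Stanley decomposition without
  zero-dimensional pieces. In the remaining cases a perfect matching of the cycle minus one vertex
  (resp. the single vertex itself for \<open>m = n - 1\<close>) gives a monomial in the socle.

  For even \<open>n\<close> and large \<open>t\<close> there is a monomial \<open>u\<close> whose annihilator in \<open>S/J\<^sup>t\<close> is \<open>P \<inter> Q\<close>, where
  \<open>P\<close> and \<open>Q\<close> are generated by the two parity classes of variables. The map \<open>(x\<^sub>1, \<dots>, x\<^sub>n) \<rightarrow> S/J\<^sup>t\<close>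
  that sends \<open>h\<close> to \<open>u (h mod P)\<close> is not multiplication by an element, which it would be if there
  were a regular sequence of length 2. A multiple of \<open>u\<close> has annihilator \<open>P\<close>, which bounds the Stanley
  depth by \<open>n / 2\<close>.
\<close>

section \<open>Edge covers of cycles\<close>

abbreviation nxt :: "nat \<Rightarrow> nat \<Rightarrow> nat" where "nxt n v \<equiv> Suc v mod n"

lemma nxt_less: "v < n \<Longrightarrow> nxt n v < n" by simp

lemma nxt_inj: "u < n \<Longrightarrow> v < n \<Longrightarrow> nxt n u = nxt n v \<Longrightarrow> u = v"
  by (auto simp: mod_Suc split: if_splits)

lemma nxt_neq: "2 \<le> n \<Longrightarrow> v < n \<Longrightarrow> nxt n v \<noteq> v"
  by (auto simp: mod_Suc split: if_splits)

lemma inj_on_nxt: "inj_on (nxt n) {..<n}"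
  by (auto intro!: inj_onI dest: nxt_inj)

lemma nxt_surj: "v < n \<Longrightarrow> \<exists>e<n. nxt n e = v"
  by (intro exI[of _ "if v = 0 then n - 1 else v - 1"]) (auto simp: mod_Suc)

definition stable :: "nat \<Rightarrow> nat set \<Rightarrow> bool" where
  "stable n W \<longleftrightarrow> W \<subseteq> {..<n} \<and> (\<forall>v\<in>W. nxt n v \<notin> W)"

lemma stable_finite: "stable n W \<Longrightarrow> finite W"
  by (auto simp: stable_def intro: finite_subset)

text \<open>\<open>nxt n\<close> maps a stable set injectively onto a disjoint copy of itself. This
  bounds its size and, if it has \<open>n / 2\<close> elements, makes it and its successors fill the
  cycle.\<close>

lemma card_stable:
  assumes "stable n W" shows "card (W \<union> nxt n ` W) = 2 * card W"
proof -
  have "card (nxt n ` W) = card W"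
    using assms by (intro card_image inj_on_subset[OF inj_on_nxt]) (auto simp: stable_def)
  moreover have "W \<inter> nxt n ` W = {}" using assms by (auto simp: stable_def)
  ultimately show ?thesis using assms by (simp add: card_Un_disjoint stable_finite)
qed

lemma stable_closure: "stable n W \<Longrightarrow> W \<union> nxt n ` W \<subseteq> {..<n}"
  by (auto simp: stable_def)

lemma stable_card_le: "stable n W \<Longrightarrow> 2 * card W \<le> n"
  using card_stable[of n W] card_mono[OF _ stable_closure, of n W] by simp

text \<open>Edge \<open>e\<close> joins \<open>e\<close> and \<open>nxt n e\<close>, so the edges at
  the vertex \<open>nxt n e\<close> are \<open>e\<close> and \<open>nxt n e\<close>. Writing every
  vertex as a successor avoids a predecessor map. \<open>d\<close> is the demand, \<open>y\<close>
  the multiplicity of edges.\<close>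

definition covers :: "nat \<Rightarrow> (nat \<Rightarrow> nat) \<Rightarrow> (nat \<Rightarrow> nat) \<Rightarrow> bool" where
  "covers n y d \<longleftrightarrow> (\<forall>e<n. d (nxt n e) \<le> y e + y (nxt n e))"

text \<open>A weight that never rises along the cycle has to return to its starting value, so it
  cannot drop either.\<close>

lemma antimono_cycle_const:
  fixes d :: "nat \<Rightarrow> nat"
  assumes "\<And>i. i < n \<Longrightarrow> d (nxt n i) \<le> d i" "v < n"
  shows "d v = d 0"
proof -
  have le: "d j \<le> d i" if "i \<le> j" "j < n" for i j
    using that
  proof (induction j rule: dec_induct)
    case (step m)
    then show ?case using assms(1)[of m] by (simp add: mod_Suc)
  qed simp
  have "d 0 \<le> d (n - 1)" using assms(1)[of "n - 1"] assms(2) by simp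
  moreover have "d v \<le> d 0" using le[of 0 v] assms(2) by blast
  moreover have "d (n - 1) \<le> d v" using le[of v "n - 1"] assms(2) by linarith
  ultimately show ?thesis by linarith
qed

text \<open>A min-max theorem, proved by spending one edge at a time. A vertex of demand 0 opens the
  cycle into a path, where stable sets are the only obstruction; if all demands are positive, the
  total weight can obstruct as well, because an edge serves only two vertices.\<close>

lemma edge_cover_exists:
  fixes d :: "nat \<Rightarrow> nat"
  assumes n: "3 \<le> n"
    and "\<And>W. stable n W \<Longrightarrow> sum d W \<le> t"
    and "(\<forall>v<n. 0 < d v) \<Longrightarrow> sum d {..<n} \<le> 2 * t"
  shows "\<exists>y. sum y {..<n} = t \<and> covers n y d"
  using assms(2,3)
proof (induction t arbitrary: d)
  case 0
  have "d v = 0" if "v < n" for v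
    using 0(1)[of "{v}"] that n nxt_neq[of n v] by (auto simp: stable_def)
  then show ?case using n by (intro exI[of _ "\<lambda>_. 0"]) (auto simp: covers_def)
next
  case (Suc t)
  show ?case
  proof (cases "\<forall>v<n. d v = 0")
    case True
    then show ?thesis
      using n by (intro exI[of _ "\<lambda>e. if e = 0 then Suc t else 0"])
        (auto simp: covers_def sum.delta)
  next
    case False
    \<comment> \<open>The demand that remains after one copy of edge \<open>j\<close> has been
      spent.\<close>
    define red where "red j v = (if v = j \<or> v = nxt n j then d v - 1 else d v)" for j v
    \<comment> \<open>The subtraction in \<open>red\<close> is truncated and leaves demand 0
      unchanged. Hence a stable set that still obstructs may contain an end of edge \<open>j\<close>
      only with demand 0.\<close>
    have hit: "Suc t = sum d W \<and> (j \<in> W \<longrightarrow> d j = 0) \<and> (nxt n j \<in> W \<longrightarrow> d (nxt n j) = 0)"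
      if W: "stable n W" and "\<not> sum (red j) W \<le> t" for j W
    proof -
      note fin = stable_finite[OF W]
      have "sum (red j) W \<le> sum d W" by (intro sum_mono) (auto simp: red_def)
      then have eq: "sum (red j) W = sum d W" and s: "Suc t = sum d W"
        using that(2) Suc.prems(1)[OF W] by auto
      have "\<not> red j v < d v" if "v \<in> W" for v
      proof
        assume "red j v < d v"
        then have "sum (red j) W < sum d W"
          using that fin by (intro sum_strict_mono_ex1 bexI[of _ v] ballI) (simp_all add: red_def)
        with eq show False by simp
      qed
      then show ?thesis using s by (fastforce simp: red_def)
    qed
    have "\<exists>j<n. 0 < d j \<and> (\<forall>W. stable n W \<longrightarrow> sum (red j) W \<le> t)"
    proof (cases "\<exists>i<n. d i < d (nxt n i)")
      case True
      then obtain i where i: "i < n" "d i < d (nxt n i)" by blast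
      \<comment> \<open>The edge to be spent leaves the upper end \<open>j\<close> of a rise;
        \<open>i\<close> and \<open>k\<close> are the neighbours of \<open>j\<close>.\<close>
      define j k where "j = nxt n i" and "k = nxt n j"
      have j: "j < n" "0 < d j" using i by (auto simp: j_def)
      have "sum (red j) W \<le> t" if W: "stable n W" for W
      proof (rule ccontr)
        assume "\<not> ?thesis"
        from hit[OF W this] j have s: "Suc t = sum d W" and jW: "j \<notin> W" and kW: "k \<in> W \<Longrightarrow> d k = 0"
          by (auto simp: k_def)
        note fin = stable_finite[OF W]
        \<comment> \<open>An exchange: an obstructing \<open>W\<close> avoids \<open>j\<close>, and
          trading \<open>i\<close> and \<open>k\<close> for \<open>j\<close> gives a stable set of
          larger weight, as \<open>k\<close> contributes nothing and
          \<open>d i < d j\<close>.\<close>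
        have "stable n (insert j (W - {i, k}))"
          unfolding stable_def
        proof (intro conjI ballI)
          show "insert j (W - {i, k}) \<subseteq> {..<n}" using W j by (auto simp: stable_def)
          fix v assume "v \<in> insert j (W - {i, k})"
          then consider "v = j" | "v \<in> W" "v \<noteq> i" by blast
          then show "nxt n v \<notin> insert j (W - {i, k})"
          proof cases
            case 1
            then show ?thesis using nxt_neq[of n j] j n by (simp add: k_def)
          next
            case 2
            then show ?thesis using W i nxt_inj[of v n i] by (auto simp: stable_def j_def)
          qed
        qed
        from Suc.prems(1)[OF this] jW fin have "d j + sum d (W - {i, k}) \<le> Suc t" by simp
        moreover have "sum d W \<le> sum d (W - {i, k}) + d i"
        proof -
          have "sum d W = sum d (W - {i, k}) + sum d (W \<inter> {i, k})"
            using sum.Int_Diff[OF fin, of d "{i, k}"] by simp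
          also have "sum d (W \<inter> {i, k}) \<le> d i"
            using kW by (cases "i = k"; cases "i \<in> W"; cases "k \<in> W") auto
          finally show ?thesis by simp
        qed
        ultimately show False using s i by (simp add: j_def)
      qed
      with j show ?thesis by blast
    next
      case nt: False
      \<comment> \<open>Without a rise the demand is constant, and edge \<open>0\<close> can be
        spent.\<close>
      define c where "c = d 0"
      have c: "d v = c" if "v < n" for v
        unfolding c_def by (rule antimono_cycle_const[OF _ that]) (meson nt not_less)
      have c0: "0 < c" using False c by auto
      have tot: "n * c \<le> 2 * Suc t" using Suc.prems(2) c c0 by simp
      have "sum (red 0) W \<le> t" if W: "stable n W" for W
      proof (rule ccontr)
        assume "\<not> ?thesis"
        from hit[OF W this] have s: "Suc t = sum d W" and h: "0 \<notin> W" "nxt n 0 \<notin> W"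
          using c[of 0] c[of "nxt n 0"] c0 n by auto
        have "sum d W = card W * c" using c W by (subst sum.cong[of W W d "\<lambda>_. c"]) (auto simp: stable_def)
        \<comment> \<open>Neither end of edge \<open>0\<close> lies in \<open>W\<close>, so
          \<open>nxt n 0\<close> is also not a successor of an element of \<open>W\<close>. This
          saves one vertex in the count, which contradicts the bound on the total weight.\<close>
        moreover have "W \<union> nxt n ` W \<subseteq> {..<n} - {nxt n 0}"
          using stable_closure[OF W] h W n nxt_inj[of _ n 0] by (auto simp: stable_def)
        from card_mono[OF _ this] have "2 * card W \<le> n - 1"
          using card_stable[OF W] n by (simp add: card_Diff_subset)
        then have "2 * card W * c \<le> (n - 1) * c" by (rule mult_right_mono) simp
        moreover have "(n - 1) * c < n * c" using n c0 by simp
        ultimately show False using s tot by simp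
      qed
      then show ?thesis using n c[of 0] c0 by (intro exI[of _ 0]) auto
    qed
    then obtain j where j: "j < n" "0 < d j" and st: "\<And>W. stable n W \<Longrightarrow> sum (red j) W \<le> t"
      by blast
    have neq: "nxt n j \<noteq> j" using nxt_neq[of n j] n j by simp
    \<comment> \<open>If no demand becomes 0, both ends of edge \<open>j\<close> lose 1, so the
      total drops by exactly 2, in step with the bound.\<close>
    have "sum (red j) {..<n} \<le> 2 * t" if pos: "\<forall>v<n. 0 < red j v"
    proof -
      have "d v = red j v + (if v = j then 1 else 0) + (if v = nxt n j then 1 else 0)" if "v < n" for v
        using pos[rule_format, OF that] neq by (auto simp: red_def split: if_splits)
      then have "sum d {..<n} = sum (red j) {..<n} + 2"
        using j by (simp add: sum.distrib sum.delta)
      moreover have "0 < d v" if "v < n" for v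
        using pos[rule_format, OF that] by (auto simp: red_def split: if_splits)
      ultimately show ?thesis using Suc.prems(2) by simp
    qed
    from Suc.IH[OF st this] obtain y where y: "sum y {..<n} = t" "covers n y (red j)" by blast
    define y' where "y' e = y e + (if e = j then 1 else 0)" for e
    have "sum y' {..<n} = Suc t" using y j by (simp add: y'_def sum.distrib sum.delta)
    moreover have "covers n y' d"
      unfolding covers_def
    proof (intro allI impI)
      fix e assume e: "e < n"
      then have "red j (nxt n e) \<le> y e + y (nxt n e)" using y by (simp add: covers_def)
      moreover have "nxt n e = nxt n j \<Longrightarrow> e = j" using nxt_inj e j by blast
      ultimately show "d (nxt n e) \<le> y' e + y' (nxt n e)"
        using neq by (auto simp: red_def y'_def split: if_splits)
    qed
    ultimately show ?thesis by blast
  qed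
qed

text \<open>An edge has at most one end in a stable set: the edges that arrive at \<open>W\<close>
  and those that leave it are disjoint. Demands have to be met inside \<open>W\<close> only, so that
  a vertex outside of \<open>W\<close> may be dropped.\<close>

lemma stable_weight_le:
  fixes d y :: "nat \<Rightarrow> nat"
  assumes W: "stable n W"
    and cov: "\<And>e. e < n \<Longrightarrow> nxt n e \<in> W \<Longrightarrow> d (nxt n e) \<le> y e + y (nxt n e)"
  shows "sum d W \<le> sum y {..<n}"
proof -
  define U where "U = {e. e < n \<and> nxt n e \<in> W}"
  have WU: "W = nxt n ` U" using W nxt_surj[of _ n] by (fastforce simp: U_def stable_def)
  have inj: "inj_on (nxt n) U" by (rule inj_on_subset[OF inj_on_nxt]) (auto simp: U_def)
  have "sum d W = (\<Sum>e\<in>U. d (nxt n e))" unfolding WU by (simp add: sum.reindex[OF inj])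
  also have "\<dots> \<le> (\<Sum>e\<in>U. y e + y (nxt n e))" by (intro sum_mono cov) (auto simp: U_def)
  also have "\<dots> = sum y U + sum y W"
    by (subst WU) (simp add: sum.distrib sum.reindex[OF inj])
  also have "\<dots> = sum y (U \<union> W)"
    using W by (intro sum.union_disjoint[symmetric]) (auto simp: U_def stable_def intro: finite_subset)
  also have "\<dots> \<le> sum y {..<n}" using W by (intro sum_mono2) (auto simp: U_def stable_def)
  finally show ?thesis .
qed

section \<open>Parity classes and matchings\<close>

lemma card_even_below: "card {v. v < 2 * s \<and> even v} = s"
proof -
  have "{v. v < 2 * s \<and> even v} = (*) 2 ` {..<s}" by auto
  then show ?thesis by (simp add: card_image inj_on_def)
qed

lemma card_odd_below: "card {v. v < 2 * s \<and> odd v} = s"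
proof -
  have "{v. v < 2 * s \<and> odd v} = (\<lambda>k. 2 * k + 1) ` {..<s}" by (auto elim!: oddE)
  then show ?thesis by (simp add: card_image inj_on_def)
qed

text \<open>A stable set misses \<open>0\<close> or \<open>1\<close>, so it keeps its weight when
  that vertex is dropped. The total weight is the sum over two stable sets if \<open>n\<close> is
  even; for odd \<open>n\<close> and small \<open>t\<close>, positive demands everywhere would
  already exceed \<open>t\<close> on a stable set.\<close>

lemma edge_cover_saturated:
  fixes d :: "nat \<Rightarrow> nat"
  assumes n: "3 \<le> n" and par: "even n \<or> 2 * t < n - 1"
    and off: "\<And>i. i < n \<Longrightarrow> \<exists>y. sum y {..<n} = t \<and>
                 (\<forall>e<n. nxt n e \<noteq> i \<longrightarrow> d (nxt n e) \<le> y e + y (nxt n e))"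
  shows "\<exists>y. sum y {..<n} = t \<and> covers n y d"
proof (rule edge_cover_exists[OF n])
  show st: "sum d W \<le> t" if W: "stable n W" for W
  proof -
    have "\<not> (0 \<in> W \<and> 1 \<in> W)" using W n by (fastforce simp: stable_def)
    moreover have "0 < n" "1 < n" using n by simp_all
    ultimately obtain i where i: "i < n" "i \<notin> W" by blast
    from off[OF i(1)] obtain y where y: "sum y {..<n} = t"
      "\<And>e. e < n \<Longrightarrow> nxt n e \<noteq> i \<Longrightarrow> d (nxt n e) \<le> y e + y (nxt n e)" by blast
    show ?thesis using stable_weight_le[OF W, of d y] y i by auto
  qed
  show "sum d {..<n} \<le> 2 * t" if pos: "\<forall>v<n. 0 < d v"
  proof (cases "even n")
    case True
    let ?E = "{v. v < n \<and> even v}" and ?O = "{v. v < n \<and> odd v}"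
    have "sum d {..<n} = sum d ({..<n} \<inter> {v. even v}) + sum d ({..<n} - {v. even v})"
      by (rule sum.Int_Diff) simp
    moreover have "{..<n} \<inter> {v. even v} = ?E" "{..<n} - {v. even v} = ?O" by auto
    ultimately have "sum d {..<n} = sum d ?E + sum d ?O" by simp
    moreover have "stable n ?E" "stable n ?O"
      using True n by (auto simp: stable_def mod_Suc split: if_splits)
    ultimately show ?thesis using st[of ?E] st[of ?O] by linarith
  next
    case False
    then obtain s where s: "n = 2 * s + 1" by (elim oddE)
    \<comment> \<open>The vertex \<open>2 * s\<close> is even too, but adjacent to \<open>0\<close>,
      and is left out.\<close>
    let ?E = "{v. v < 2 * s \<and> even v}"
    have "stable n ?E" using s by (auto simp: stable_def)
    then have "sum d ?E \<le> t" by (rule st)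
    moreover have "(\<Sum>v\<in>?E. 1) \<le> sum d ?E" using pos s by (intro sum_mono) (auto simp: Suc_le_eq)
    moreover have "card ?E = s" by (rule card_even_below)
    ultimately show ?thesis using par s by simp
  qed
qed

text \<open>Deleting a vertex of an odd cycle leaves a path with an even number of vertices. The
  demand 0 at \<open>i\<close> makes the condition on the total weight vacuous.\<close>

lemma near_perfect_matching:
  assumes n: "n = 2 * s + 1" "3 \<le> n" and i: "i < n"
  shows "\<exists>y. sum y {..<n} = s \<and> covers n y (\<lambda>v. if v = i then 0 else 1)"
    (is "\<exists>y. _ \<and> covers n y ?d")
proof (rule edge_cover_exists[OF n(2)])
  fix W assume W: "stable n W"
  have "sum ?d W \<le> (\<Sum>v\<in>W. 1)" by (intro sum_mono) auto
  then show "sum ?d W \<le> s" using stable_card_le[OF W] n by simp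
qed (use i in auto)

text \<open>A stable set of \<open>s\<close> vertices is one of the two parity classes, so it
  contains \<open>i\<close> or \<open>j\<close> and has demand at most \<open>s - 1\<close>.\<close>

lemma bipartite_matching_off:
  assumes n: "n = 2 * s" "3 \<le> n" and ij: "i < n" "j < n" "odd i" "even j"
  shows "\<exists>y. sum y {..<n} = s - 1 \<and> covers n y (\<lambda>v. if v = i \<or> v = j then 0 else 1)"
    (is "\<exists>y. _ \<and> covers n y ?d")
proof (rule edge_cover_exists[OF n(2)])
  fix W assume W: "stable n W"
  note fin = stable_finite[OF W]
  have le: "2 * card W \<le> n" by (rule stable_card_le[OF W])
  have sum: "sum ?d W = card (W - {i, j})"
  proof -
    have "sum ?d W = sum ?d (W - {i, j})" using fin by (intro sum.mono_neutral_right) auto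
    also have "\<dots> = (\<Sum>v\<in>W - {i, j}. 1)" by (intro sum.cong) auto
    finally show ?thesis by simp
  qed
  show "sum ?d W \<le> s - 1"
  proof (rule ccontr)
    assume "\<not> ?thesis"
    moreover have "card (W - {i, j}) \<le> card W" using fin by (intro card_mono) auto
    ultimately have c: "card W = s" "card (W - {i, j}) = card W" using sum le n by auto
    have "W - {i, j} = W" using c fin by (intro card_subset_eq) auto
    then have ijW: "i \<notin> W" "j \<notin> W" by auto
    have full: "W \<union> nxt n ` W = {..<n}"
      using card_stable[OF W] c n by (intro card_subset_eq stable_closure[OF W]) auto
    \<comment> \<open>As \<open>W\<close> and its successors fill the cycle, membership in
      \<open>W\<close> alternates, so \<open>W\<close> is a parity class.\<close>
    have step: "nxt n v \<in> W \<longleftrightarrow> v \<notin> W" if v: "v < n" for v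
    proof -
      have "nxt n v \<in> W \<union> nxt n ` W" using full v by simp
      then show ?thesis using W v nxt_inj[of v n] by (auto simp: stable_def)
    qed
    have "v \<in> W \<longleftrightarrow> (even v \<longleftrightarrow> 0 \<in> W)" if "v < n" for v
      using that
    proof (induction v)
      case (Suc v)
      then have "v < n" "v \<in> W \<longleftrightarrow> (even v \<longleftrightarrow> 0 \<in> W)" "Suc v \<in> W \<longleftrightarrow> v \<notin> W"
        using step[of v] by simp_all
      then show ?case unfolding even_Suc by blast
    qed simp
    then show False using ij ijW by blast
  qed
qed (use ij in auto)

section \<open>Exponents of powers\<close>

text \<open>The vertex \<open>v < n\<close> of the cycle stands for the variable \<open>x\<^sub>v\<^sub>+\<^sub>1\<close>.\<close>

definition expo :: "nat \<Rightarrow> (nat \<Rightarrow> nat) \<Rightarrow> nat \<Rightarrow>\<^sub>0 nat" where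
  "expo n f = (\<Sum>v<n. Poly_Mapping.single (Suc v) (f v))"

lemma lookup_expo:
  "Poly_Mapping.lookup (expo n f) i = (if i \<in> {1..n} then f (i - 1) else 0)"
proof (cases i)
  case 0
  then show ?thesis by (simp add: expo_def lookup_sum lookup_single)
next
  case (Suc j)
  have "Poly_Mapping.lookup (expo n f) i = (\<Sum>v<n. if v = j then f v else 0)"
    unfolding expo_def lookup_sum by (intro sum.cong) (auto simp: Suc lookup_single when_def)
  then show ?thesis by (simp add: Suc Suc_le_eq)
qed

lemma lookup_expo_Suc [simp]:
  "Poly_Mapping.lookup (expo n f) (Suc v) = (if v < n then f v else 0)"
  by (simp add: lookup_expo Suc_le_eq)

lemma in_exponents_iff:
  "a \<in> exponents V \<longleftrightarrow> (\<forall>i. i \<notin> V \<longrightarrow> Poly_Mapping.lookup a i = 0)"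
  by (auto simp: exponents_def in_keys_iff)

lemma zero_in_exponents [simp]: "0 \<in> exponents V"
  by (simp add: in_exponents_iff)

lemma exponents_add: "a \<in> exponents V \<Longrightarrow> b \<in> exponents V \<Longrightarrow> a + b \<in> exponents V"
  by (simp add: in_exponents_iff lookup_add)

lemma exponents_mono: "U \<subseteq> V \<Longrightarrow> exponents U \<subseteq> exponents V"
  by (auto simp: exponents_def)

lemma single_in_exponents [simp]: "i \<in> V \<Longrightarrow> Poly_Mapping.single i k \<in> exponents V"
  by (auto simp: in_exponents_iff lookup_single when_def)

lemma expo_in_exponents [simp]: "expo n f \<in> exponents {Suc 0..n}"
  by (simp add: in_exponents_iff lookup_expo)

lemma expo_of_lookup:
  assumes "a \<in> exponents {1..n}"
  shows "expo n (\<lambda>v. Poly_Mapping.lookup a (Suc v)) = a"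
  using assms by (intro poly_mapping_eqI) (auto simp: lookup_expo in_exponents_iff)

lemma expo_add: "expo n f + expo n g = expo n (\<lambda>v. f v + g v)"
  by (intro poly_mapping_eqI) (auto simp: lookup_expo lookup_add)

lemma expo_eq_iff: "expo n f = expo n g \<longleftrightarrow> (\<forall>v<n. f v = g v)"
proof
  assume "expo n f = expo n g"
  then have "Poly_Mapping.lookup (expo n f) (Suc v) = Poly_Mapping.lookup (expo n g) (Suc v)" for v
    by simp
  then show "\<forall>v<n. f v = g v" unfolding lookup_expo_Suc by metis
qed (auto intro!: poly_mapping_eqI simp: lookup_expo)

lemma single_eq_expo: "v < n \<Longrightarrow> Poly_Mapping.single (Suc v) k = expo n (\<lambda>u. if u = v then k else 0)"
  by (intro poly_mapping_eqI) (auto simp: lookup_expo lookup_single when_def)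

section \<open>Exponents of the monomials in powers of an ideal\<close>

fun exponent_power :: "nat \<Rightarrow> (nat \<Rightarrow>\<^sub>0 nat) set \<Rightarrow> nat \<Rightarrow> (nat \<Rightarrow>\<^sub>0 nat) set" where
  "exponent_power n G 0 = exponents {1..n}"
| "exponent_power n G (Suc t) = {a + g | a g. a \<in> exponent_power n G t \<and> g \<in> G}"

lemma exponent_power_subset:
  "G \<subseteq> exponents {1..n} \<Longrightarrow> exponent_power n G t \<subseteq> exponents {1..n}"
  by (induction t) (auto intro: exponents_add)

lemma exponent_power_add:
  "a \<in> exponent_power n G t \<Longrightarrow> b \<in> exponents {1..n} \<Longrightarrow> a + b \<in> exponent_power n G t"
proof (induction t arbitrary: a)
  case (Suc t)
  then obtain c g where "a = c + g" "c \<in> exponent_power n G t" "g \<in> G" by auto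
  then have "a + b = (c + b) + g" "c + b \<in> exponent_power n G t" "g \<in> G"
    using Suc.IH[of c] Suc.prems by (simp_all add: ac_simps)
  then show ?case by auto
qed (simp add: exponents_add)

text \<open>Path generators are described by the variables that they miss, because these are only
  one or two for \<open>m = n - 1\<close> and \<open>m = n - 2\<close>.\<close>

definition omit :: "nat \<Rightarrow> (nat \<Rightarrow> nat set) \<Rightarrow> (nat \<Rightarrow>\<^sub>0 nat) set" where
  "omit n N = (\<lambda>e. expo n (\<lambda>v. if v \<in> N e then 0 else 1)) ` {..<n}"

definition hits :: "nat \<Rightarrow> (nat \<Rightarrow> nat set) \<Rightarrow> nat \<Rightarrow> nat set" where
  "hits n N v = {e. e < n \<and> v \<in> N e}"

lemma finite_hits [simp]: "finite (hits n N v)"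
  by (simp add: hits_def)

lemma omit_subset: "omit n N \<subseteq> exponents {1..n}"
  by (auto simp: omit_def)

lemma sum_increment:
  fixes y :: "nat \<Rightarrow> nat"
  assumes "finite H"
  shows "(\<Sum>x\<in>H. y x + (if x = e then 1 else 0)) = sum y H + (if e \<in> H then 1 else 0)"
  using assms by (simp add: sum.distrib sum.delta')

text \<open>\<open>y e\<close> counts the uses of generator \<open>e\<close>. In a product of
  \<open>t\<close> generators the exponent at \<open>v\<close> is \<open>t\<close> minus the number
  of factors that miss \<open>v\<close>; that number is moved to the other side to avoid
  subtraction.\<close>

lemma exponent_power_omit_iff:
  "expo n f \<in> exponent_power n (omit n N) t \<longleftrightarrow>
    (\<exists>y. sum y {..<n} = t \<and> (\<forall>v<n. t \<le> f v + sum y (hits n N v)))"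
proof (induction t arbitrary: f)
  case 0
  show ?case by (auto intro: exI[of _ "\<lambda>_. 0"])
next
  case (Suc t)
  show ?case
  proof
    assume "expo n f \<in> exponent_power n (omit n N) (Suc t)"
    then obtain a e where a: "expo n f = a + expo n (\<lambda>v. if v \<in> N e then 0 else 1)"
        "a \<in> exponent_power n (omit n N) t" and e: "e < n"
      by (auto simp: omit_def)
    then have "a \<in> exponents {1..n}" using exponent_power_subset[OF omit_subset] by blast
    from expo_of_lookup[OF this] obtain h where h: "a = expo n h" by metis
    from a h have f: "\<forall>v<n. f v = h v + (if v \<in> N e then 0 else 1)"
      by (simp add: expo_add expo_eq_iff)
    from a h Suc.IH obtain y where y: "sum y {..<n} = t" "\<forall>v<n. t \<le> h v + sum y (hits n N v)"
      by auto
    define y' where "y' x = y x + (if x = e then 1 else 0)" for x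
    have "sum y' {..<n} = Suc t" unfolding y'_def using y e by (subst sum_increment) auto
    moreover have "sum y' (hits n N v) = sum y (hits n N v) + (if v \<in> N e then 1 else 0)" for v
      unfolding y'_def using e by (subst sum_increment) (auto simp: hits_def)
    ultimately show "\<exists>y. sum y {..<n} = Suc t \<and> (\<forall>v<n. Suc t \<le> f v + sum y (hits n N v))"
      using y f by (intro exI[of _ y']) auto
  next
    assume "\<exists>y. sum y {..<n} = Suc t \<and> (\<forall>v<n. Suc t \<le> f v + sum y (hits n N v))"
    then obtain y where y: "sum y {..<n} = Suc t" "\<forall>v<n. Suc t \<le> f v + sum y (hits n N v)"
      by blast
    then obtain e where e: "e < n" "0 < y e"
      by (metis finite_lessThan lessThan_iff not_gr_zero sum.neutral zero_neq_one nat.distinct(1))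
    define y' where "y' x = y x - (if x = e then 1 else 0)" for x
    have yy': "y x = y' x + (if x = e then 1 else 0)" for x
      using e by (auto simp: y'_def)
    have inc: "sum y H = sum y' H + (if e \<in> H then 1 else 0)" if "finite H" for H
      using sum_increment[OF that, of y' e] by (simp only: yy'[symmetric])
    have s: "sum y {..<n} = sum y' {..<n} + 1" using e by (simp add: inc)
    have h: "sum y (hits n N v) = sum y' (hits n N v) + (if v \<in> N e then 1 else 0)" for v
      using e by (simp add: inc) (simp add: hits_def)
    \<comment> \<open>At most \<open>t\<close> of the remaining factors miss \<open>v\<close>, so
      \<open>f v\<close> is positive wherever generator \<open>e\<close> contains the variable, and
      the truncated subtraction in \<open>g\<close> below is exact.\<close>
    have bound: "sum y' (hits n N v) \<le> t" for v
    proof -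
      have "sum y' (hits n N v) \<le> sum y' {..<n}" by (intro sum_mono2) (auto simp: hits_def)
      then show ?thesis using s y by simp
    qed
    define g where "g v = f v - (if v \<in> N e then 0 else 1)" for v
    have fg: "f v = g v + (if v \<in> N e then 0 else 1)" if "v < n" for v
      using y(2)[rule_format, OF that] bound[of v] by (auto simp: g_def h split: if_splits)
    have "\<forall>v<n. t \<le> g v + sum y' (hits n N v)"
      using y(2) by (auto simp: g_def h split: if_splits)
    then have "expo n g \<in> exponent_power n (omit n N) t"
      using s y by (subst Suc.IH) (auto intro!: exI[of _ y'])
    moreover have "expo n f = expo n g + expo n (\<lambda>v. if v \<in> N e then 0 else 1)"
      using fg by (simp add: expo_add expo_eq_iff)
    ultimately show "expo n f \<in> exponent_power n (omit n N) (Suc t)"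
      using e by (auto simp: omit_def)
  qed
qed

text \<open>The criterion is summed over \<open>V\<close> and counted by generators instead of
  vertices. This degree bound is the test by which monomials are shown to lie outside of a
  power.\<close>

lemma exponent_power_omit_sum_ge:
  assumes "expo n f \<in> exponent_power n (omit n N) t"
    and V: "V \<subseteq> {..<n}" and c: "\<And>e. e < n \<Longrightarrow> card (V \<inter> N e) \<le> c"
  shows "t * card V \<le> sum f V + t * c"
proof -
  obtain y where y: "sum y {..<n} = t" "\<forall>v<n. t \<le> f v + sum y (hits n N v)"
    using assms(1) by (auto simp: exponent_power_omit_iff)
  have fin: "finite V" using V finite_subset by blast
  have "t * card V = (\<Sum>v\<in>V. t)" by simp
  also have "\<dots> \<le> (\<Sum>v\<in>V. f v + sum y (hits n N v))" using y V by (intro sum_mono) auto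
  also have "\<dots> = sum f V + (\<Sum>v\<in>V. sum y (hits n N v))" by (simp add: sum.distrib)
  also have "(\<Sum>v\<in>V. sum y (hits n N v)) = (\<Sum>v\<in>V. \<Sum>e<n. if v \<in> N e then y e else 0)"
    by (intro sum.cong refl sum.mono_neutral_cong_left) (auto simp: hits_def)
  also have "\<dots> = (\<Sum>e<n. \<Sum>v\<in>V. if v \<in> N e then y e else 0)" by (rule sum.swap)
  also have "\<dots> = (\<Sum>e<n. card (V \<inter> N e) * y e)"
    using fin by (intro sum.cong refl) (simp add: sum.If_cases)
  also have "\<dots> \<le> (\<Sum>e<n. c * y e)" using c by (intro sum_mono mult_right_mono) auto
  also have "\<dots> = t * c" using y by (simp add: sum_distrib_left[symmetric])
  finally show ?thesis by simp
qed

definition trunc :: "nat \<Rightarrow> nat \<Rightarrow> (nat \<Rightarrow>\<^sub>0 nat) \<Rightarrow> nat \<Rightarrow>\<^sub>0 nat" where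
  "trunc n g a = expo n (\<lambda>v. min (Poly_Mapping.lookup a (Suc v)) g)"

text \<open>The criterion compares \<open>t\<close> with \<open>f v\<close> plus a natural number,
  so cutting \<open>f v\<close> at \<open>t\<close> does not affect it.\<close>

lemma exponent_power_omit_trunc:
  assumes "a \<in> exponents {1..n}"
  shows "trunc n t a \<in> exponent_power n (omit n N) t \<longleftrightarrow> a \<in> exponent_power n (omit n N) t"
proof -
  have "expo n (\<lambda>v. min (f v) t) \<in> exponent_power n (omit n N) t \<longleftrightarrow>
      expo n f \<in> exponent_power n (omit n N) t" for f
    unfolding exponent_power_omit_iff
    by (intro ex_cong1 conj_cong refl all_cong) (auto simp: min_def)
  then show ?thesis unfolding trunc_def by (metis expo_of_lookup[OF assms])
qed

section \<open>Monomial ideals\<close>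

definition monomial_span :: "(nat \<Rightarrow>\<^sub>0 nat) set \<Rightarrow> 'k::comm_ring_1 mpoly set" where
  "monomial_span A = {p. Poly_Mapping.keys p \<subseteq> A}"

lemma carrier_poly_ring: "carrier (poly_ring V) = monomial_span (exponents V)"
  by (simp add: poly_ring_def monomial_span_def)

lemma poly_ring_simps [simp]:
  "x \<otimes>\<^bsub>poly_ring V\<^esub> y = x * y" "x \<oplus>\<^bsub>poly_ring V\<^esub> y = x + y"
  "\<one>\<^bsub>poly_ring V\<^esub> = 1" "\<zero>\<^bsub>poly_ring V\<^esub> = 0"
  by (simp_all add: poly_ring_def)

lemma monomial_span_zero [simp]: "0 \<in> monomial_span A"
  by (simp add: monomial_span_def)

lemma monomial_span_add: "p \<in> monomial_span A \<Longrightarrow> q \<in> monomial_span A \<Longrightarrow> p + q \<in> monomial_span A"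
  using Poly_Mapping.keys_add[of p q] by (auto simp: monomial_span_def)

lemma monomial_span_sum:
  "(\<And>x. x \<in> X \<Longrightarrow> p x \<in> monomial_span A) \<Longrightarrow> sum p X \<in> monomial_span A"
  by (induction X rule: infinite_finite_induct) (auto intro: monomial_span_add)

lemma monomial_span_uminus: "p \<in> monomial_span A \<Longrightarrow> - p \<in> monomial_span A"
  by (auto simp: monomial_span_def in_keys_iff)

lemma monomial_span_diff: "p \<in> monomial_span A \<Longrightarrow> q \<in> monomial_span A \<Longrightarrow> p - q \<in> monomial_span A"
  using monomial_span_add[OF _ monomial_span_uminus, of p A q] by simp

lemma monomial_span_mult:
  assumes "p \<in> monomial_span A" "q \<in> monomial_span B"
    and "\<And>a b. a \<in> A \<Longrightarrow> b \<in> B \<Longrightarrow> a + b \<in> C"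
  shows "p * q \<in> monomial_span C"
  using assms Poly_Mapping.keys_mult[of p q] unfolding monomial_span_def by blast

lemma monomial_span_lookup: "p \<in> monomial_span A \<Longrightarrow> a \<notin> A \<Longrightarrow> Poly_Mapping.lookup p a = 0"
  by (auto simp: monomial_span_def in_keys_iff)

lemma monomial_span_mono: "A \<subseteq> B \<Longrightarrow> monomial_span A \<subseteq> monomial_span B"
  by (auto simp: monomial_span_def)

lemma single_in_monomial_span: "a \<in> A \<Longrightarrow> Poly_Mapping.single a c \<in> monomial_span A"
  by (auto simp: monomial_span_def)

lemma monomial_in_monomial_span [simp]:
  "(monomial a :: 'k::comm_ring_1 mpoly) \<in> monomial_span A \<longleftrightarrow> a \<in> A"
  by (simp add: monomial_def monomial_span_def)

lemma poly_sum_singles: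
  "(\<Sum>a\<in>Poly_Mapping.keys p. Poly_Mapping.single a (Poly_Mapping.lookup p a)) = p"
  by (rule poly_mapping_eqI)
    (auto simp: lookup_sum lookup_single when_def sum.delta in_keys_iff)

lemma uminus_poly_ring:
  fixes p :: "'k::comm_ring_1 mpoly"
  assumes "p \<in> carrier (poly_ring V)"
  shows "\<ominus>\<^bsub>poly_ring V\<^esub> p = - p"
proof -
  interpret cring "poly_ring V :: 'k mpoly ring" by (rule poly_ring_cring)
  show ?thesis
    using assms by (intro minus_equality) (auto simp: carrier_poly_ring monomial_span_uminus)
qed

lemma minus_poly_ring:
  fixes p q :: "'k::comm_ring_1 mpoly"
  assumes "p \<in> carrier (poly_ring V)" "q \<in> carrier (poly_ring V)"
  shows "p \<ominus>\<^bsub>poly_ring V\<^esub> q = p - q"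
  using assms by (simp add: a_minus_def uminus_poly_ring)

lemma monomial_span_ideal:
  assumes A: "A \<subseteq> exponents V" and add: "\<And>a b. a \<in> A \<Longrightarrow> b \<in> exponents V \<Longrightarrow> a + b \<in> A"
  shows "ideal (monomial_span A :: 'k::comm_ring_1 mpoly set) (poly_ring V)"
proof -
  interpret cring "poly_ring V :: 'k mpoly ring" by (rule poly_ring_cring)
  have sub: "monomial_span A \<subseteq> carrier (poly_ring V :: 'k mpoly ring)"
    using A by (simp add: carrier_poly_ring monomial_span_mono)
  show ?thesis
  proof (rule idealI)
    show "subgroup (monomial_span A) (add_monoid (poly_ring V :: 'k mpoly ring))"
    proof (rule group.subgroupI[OF a_group])
      show "monomial_span A \<noteq> ({} :: 'k mpoly set)" using monomial_span_zero by blast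
      fix p :: "'k mpoly" assume "p \<in> monomial_span A"
      then show "inv\<^bsub>add_monoid (poly_ring V)\<^esub> p \<in> monomial_span A"
        using sub uminus_poly_ring[of p V] by (auto simp: a_inv_def monomial_span_uminus)
    qed (use sub in \<open>auto intro: monomial_span_add\<close>)
  next
    fix p q :: "'k mpoly" assume "p \<in> monomial_span A" "q \<in> carrier (poly_ring V)"
    then have "p * q \<in> monomial_span A"
      using add by (auto simp: carrier_poly_ring intro: monomial_span_mult)
    then show "q \<otimes>\<^bsub>poly_ring V\<^esub> p \<in> monomial_span A" "p \<otimes>\<^bsub>poly_ring V\<^esub> q \<in> monomial_span A"
      by (simp_all add: mult.commute)
  qed (rule ring_axioms)
qed

lemma single_add_mult:
  "Poly_Mapping.single (a + b) c = Poly_Mapping.single a c * (monomial b :: 'k::comm_ring_1 mpoly)"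
  by (simp add: monomial_def mult_single)

text \<open>This replaces a generated ideal by its set of exponents. Coefficients are carried by the
  cofactor of a generator, as ideals are closed under ring multiples.\<close>

lemma genideal_monomials:
  assumes G: "G \<subseteq> exponents V"
  shows "(Idl\<^bsub>poly_ring V\<^esub> (monomial ` G) :: 'k::comm_ring_1 mpoly set)
    = monomial_span {g + b | g b. g \<in> G \<and> b \<in> exponents V}" (is "?I = monomial_span ?A")
proof
  interpret cring "poly_ring V :: 'k mpoly ring" by (rule poly_ring_cring)
  have gens: "monomial ` G \<subseteq> carrier (poly_ring V :: 'k mpoly ring)"
    using G by (auto simp: carrier_poly_ring)
  have "ideal (monomial_span ?A :: 'k mpoly set) (poly_ring V)"
  proof (rule monomial_span_ideal)
    show "?A \<subseteq> exponents V" using G by (auto intro: exponents_add)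
    show "a + b \<in> ?A" if ab: "a \<in> ?A" "b \<in> exponents V" for a b
    proof -
      obtain g c where "a = g + c" "g \<in> G" "c \<in> exponents V" using ab by blast
      then have "a + b = g + (c + b)" "g \<in> G" "c + b \<in> exponents V"
        using ab by (simp_all add: add.assoc exponents_add)
      then show ?thesis by blast
    qed
  qed
  moreover have "monomial ` G \<subseteq> monomial_span ?A"
  proof -
    have "g + 0 \<in> ?A" if "g \<in> G" for g using that zero_in_exponents by blast
    then show ?thesis by auto
  qed
  ultimately show "?I \<subseteq> monomial_span ?A" by (rule genideal_minimal)
  interpret I: ideal ?I "poly_ring V :: 'k mpoly ring" by (rule genideal_ideal[OF gens])
  show "monomial_span ?A \<subseteq> ?I"
  proof
    fix p :: "'k mpoly" assume p: "p \<in> monomial_span ?A"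
    have single: "Poly_Mapping.single a c \<in> ?I" if a: "a \<in> ?A" for a and c :: 'k
    proof -
      obtain g b where ab: "a = g + b" "g \<in> G" "b \<in> exponents V" using a by blast
      have "monomial g * Poly_Mapping.single b c \<in> ?I"
        using I.I_r_closed[of "monomial g" "Poly_Mapping.single b c"] genideal_self[OF gens] ab
        by (auto simp: carrier_poly_ring single_in_monomial_span)
      then show ?thesis by (simp add: ab monomial_def mult_single)
    qed
    have "(\<Sum>a\<in>X. Poly_Mapping.single a (Poly_Mapping.lookup p a)) \<in> ?I"
      if "finite X" "X \<subseteq> ?A" for X
      using that
    proof (induction X rule: finite_induct)
      case empty
      show ?case using I.zero_closed by simp
    next
      case (insert x F)
      then show ?case using I.a_closed single by simp
    qed
    from this[of "Poly_Mapping.keys p"] show "p \<in> ?I"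
      using p by (simp add: poly_sum_singles monomial_span_def)
  qed
qed

text \<open>A coefficient can be put on the left factor, so each term is a single product, and
  \<open>ideal_prod\<close> is closed under sums.\<close>

lemma ideal_prod_monomial_span:
  "ideal_prod (poly_ring V) (monomial_span A) (monomial_span B)
    = (monomial_span {a + b | a b. a \<in> A \<and> b \<in> B} :: 'k::comm_ring_1 mpoly set)"
    (is "?P = monomial_span ?C")
proof
  show "?P \<subseteq> monomial_span ?C"
  proof
    fix p :: "'k mpoly" assume "p \<in> ?P"
    then show "p \<in> monomial_span ?C"
    proof (induction p rule: ideal_prod.induct)
      case (prod i j)
      then show ?case by (auto intro: monomial_span_mult)
    qed (auto intro: monomial_span_add)
  qed
  show "monomial_span ?C \<subseteq> ?P"
  proof
    fix p :: "'k mpoly" assume p: "p \<in> monomial_span ?C"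
    have single: "Poly_Mapping.single c x \<in> ?P" if c: "c \<in> ?C" for c and x :: 'k
    proof -
      obtain a b where ab: "c = a + b" "a \<in> A" "b \<in> B" using c by blast
      have "Poly_Mapping.single a x \<otimes>\<^bsub>poly_ring V\<^esub> monomial b \<in> ?P"
        using ab by (intro ideal_prod.prod) (simp_all add: single_in_monomial_span)
      then show ?thesis by (simp add: ab single_add_mult)
    qed
    have "(\<Sum>a\<in>X. Poly_Mapping.single a (Poly_Mapping.lookup p a)) \<in> ?P"
      if "finite X" "X \<subseteq> ?C" for X
      using that
    proof (induction X rule: finite_induct)
      case empty
      show ?case using ideal_prod.prod[of 0 "monomial_span A" 0 "monomial_span B" "poly_ring V"] by simp
    next
      case (insert x F)
      then show ?case using ideal_prod.sum[OF single, of x "sum _ F"] by simp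
    qed
    from this[of "Poly_Mapping.keys p"] show "p \<in> ?P"
      using p by (simp add: poly_sum_singles monomial_span_def)
  qed
qed

section \<open>Path ideals, their powers and the maximal ideal as spans of monomials\<close>

lemma prod_var: "(\<Prod>j\<in>X. var (f j)) = (monomial (\<Sum>j\<in>X. Poly_Mapping.single (f j) 1) :: 'k::comm_ring_1 mpoly)"
proof (induction X rule: infinite_finite_induct)
  case (insert x F)
  then show ?case by (simp add: var_def monomial_def mult_single)
qed (simp_all add: monomial_def single_one)

text \<open>A rotation permutes the vertices, so the \<open>m\<close> vertices of a path and the
  \<open>n - m\<close> following ones partition the cycle, and each path variable occurs exactly
  once.\<close>

lemma path_exponent:
  assumes "k < n" "m \<le> n"
  shows "(\<Sum>j<m. Poly_Mapping.single ((k + j) mod n + 1) (1::nat))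
    = expo n (\<lambda>v. if v \<in> (\<lambda>j. (k + j) mod n) ` {m..<n} then 0 else 1)"
    (is "?s = expo n ?f")
proof (rule poly_mapping_eqI)
  fix i
  have inj: "inj_on (\<lambda>j. (k + j) mod n) {..<n}"
  proof (rule inj_onI)
    fix x y assume xy: "x \<in> {..<n}" "y \<in> {..<n}" "(k + x) mod n = (k + y) mod n"
    have *: "(k + x) mod n = (if k + x < n then k + x else k + x - n)" if "x < n" for x
      using that assms by (auto simp: le_mod_geq)
    show "x = y" using xy assms by (auto simp: * split: if_splits)
  qed
  have surj: "(\<lambda>j. (k + j) mod n) ` {..<n} = {..<n}"
    using assms by (intro endo_inj_surj inj) auto
  show "Poly_Mapping.lookup ?s i = Poly_Mapping.lookup (expo n ?f) i"
  proof (cases "i \<in> {1..n}")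
    case True
    then obtain v where v: "i = Suc v" "v < n" by (cases i) auto
    then have "v \<in> (\<lambda>j. (k + j) mod n) ` {..<n}" by (simp only: surj lessThan_iff)
    then obtain j where j: "j < n" "(k + j) mod n = v" by auto
    have eq: "(k + j') mod n = v \<longleftrightarrow> j' = j" if "j' < n" for j'
      using inj j that by (auto simp: inj_on_def)
    have "Poly_Mapping.lookup ?s i = (\<Sum>j'<m. if j' = j then 1 else 0)"
      unfolding lookup_sum using eq assms v by (intro sum.cong) (auto simp: lookup_single when_def)
    also have "\<dots> = (if v \<in> (\<lambda>j. (k + j) mod n) ` {m..<n} then 0 else 1)"
    proof -
      have "v \<in> (\<lambda>j. (k + j) mod n) ` {m..<n} \<longleftrightarrow> m \<le> j"
      proof
        assume "v \<in> (\<lambda>j. (k + j) mod n) ` {m..<n}"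
        then obtain x where "m \<le> x" "x < n" "(k + x) mod n = v" by auto
        then show "m \<le> j" using eq[of x] by simp
      next
        assume "m \<le> j"
        then show "v \<in> (\<lambda>j. (k + j) mod n) ` {m..<n}" using j by (intro image_eqI[of _ _ j]) auto
      qed
      then show ?thesis by auto
    qed
    finally show ?thesis using v by simp
  next
    case False
    have "Poly_Mapping.lookup (Poly_Mapping.single ((k + j) mod n + 1) (1::nat)) i = 0" for j
      using False assms by (auto simp: lookup_single when_def Suc_le_eq)
    then show ?thesis using False by (simp add: lookup_sum lookup_expo)
  qed
qed

definition gap :: "nat \<Rightarrow> nat \<Rightarrow> nat \<Rightarrow> nat set" where
  "gap n m k = (\<lambda>j. (k + j) mod n) ` {m..<n}"

lemma cycle_path_ideal_eq:
  assumes "1 \<le> n" "m \<le> n"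
  shows "(cycle_path_ideal n m :: 'k::comm_ring_1 mpoly set)
    = monomial_span {g + b | g b. g \<in> omit n (gap n m) \<and> b \<in> exponents {1..n}}"
proof -
  \<comment> \<open>Variables are numbered from 1 and vertices from 0: the generator with index
    \<open>Suc k\<close> starts at the vertex \<open>k\<close>.\<close>
  have "{1..n} = Suc ` {..<n}" by (simp add: image_Suc_lessThan)
  then have "((\<lambda>i. \<Prod>j<m. var ((i + j - 1) mod n + 1)) ` {1..n} :: 'k mpoly set)
      = (\<lambda>k. monomial (\<Sum>j<m. Poly_Mapping.single ((k + j) mod n + 1) 1)) ` {..<n}"
    by (simp only: image_image prod_var) simp
  also have "\<dots> = monomial ` omit n (gap n m)"
    unfolding omit_def image_image gap_def using assms
    by (intro image_cong refl) (simp only: path_exponent lessThan_iff)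
  finally show ?thesis
    unfolding cycle_path_ideal_def by (simp only: genideal_monomials[OF omit_subset])
qed

lemma cycle_path_ideal_power_eq:
  assumes "1 \<le> n" "m \<le> n"
  shows "(cycle_path_ideal_power n m t :: 'k::comm_ring_1 mpoly set)
    = monomial_span (exponent_power n (omit n (gap n m)) t)"
proof (induction t)
  case 0
  show ?case by (simp add: cycle_path_ideal_power_def nat_pow_def ideals_set_def carrier_poly_ring)
next
  case (Suc t)
  have "(cycle_path_ideal_power n m (Suc t) :: 'k mpoly set)
      = ideal_prod (S_ring n) (cycle_path_ideal_power n m t) (cycle_path_ideal n m)"
    by (simp add: cycle_path_ideal_power_def nat_pow_def ideals_set_def)
  also have "\<dots> = monomial_span {a + c | a c. a \<in> exponent_power n (omit n (gap n m)) t \<and>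
      c \<in> {g + b | g b. g \<in> omit n (gap n m) \<and> b \<in> exponents {1..n}}}"
    by (simp only: Suc cycle_path_ideal_eq[OF assms] ideal_prod_monomial_span)
  \<comment> \<open>The cofactor \<open>b\<close> of a generator is absorbed into the power with
    exponent \<open>t\<close>.\<close>
  also have "{a + c | a c. a \<in> exponent_power n (omit n (gap n m)) t \<and>
      c \<in> {g + b | g b. g \<in> omit n (gap n m) \<and> b \<in> exponents {1..n}}}
      = exponent_power n (omit n (gap n m)) (Suc t)" (is "?L = ?R")
  proof (intro equalityI subsetI)
    fix x assume "x \<in> ?L"
    then obtain a g b where x: "x = a + (g + b)" "a \<in> exponent_power n (omit n (gap n m)) t"
      "g \<in> omit n (gap n m)" "b \<in> exponents {1..n}" by blast
    then have "x = (a + b) + g" by (simp add: ac_simps)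
    with exponent_power_add[OF x(2,4)] x(3) show "x \<in> ?R"
      unfolding exponent_power.simps by blast
  next
    fix x assume "x \<in> ?R"
    then obtain a g where x: "x = a + (g + 0)" "a \<in> exponent_power n (omit n (gap n m)) t"
      "g \<in> omit n (gap n m)" by auto
    then show "x \<in> ?L" using zero_in_exponents by blast
  qed
  finally show ?case .
qed

lemma max_ideal_eq: "(max_ideal n :: 'k::comm_ring_1 mpoly set) = monomial_span (exponents {1..n} - {0})"
proof -
  have "(max_ideal n :: 'k mpoly set) = Idl\<^bsub>S_ring n\<^esub> (monomial ` (\<lambda>i. Poly_Mapping.single i 1) ` {1..n})"
    unfolding max_ideal_def var_def[abs_def] by (simp add: image_image)
  also have "\<dots> = monomial_span {g + b | g b. g \<in> (\<lambda>i. Poly_Mapping.single i 1) ` {1..n} \<and> b \<in> exponents {1..n}}"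
    by (rule genideal_monomials) auto
  also have "{g + b | g b. g \<in> (\<lambda>i. Poly_Mapping.single i 1) ` {1..n} \<and> b \<in> exponents {1..n}}
      = exponents {1..n} - {0}" (is "?L = ?R")
  proof (intro equalityI subsetI)
    fix a assume "a \<in> ?L"
    then obtain i b where a: "a = Poly_Mapping.single i 1 + b" "i \<in> {1..n}" "b \<in> exponents {1..n}" by blast
    then have "Poly_Mapping.lookup a i \<noteq> 0" by (simp add: lookup_add)
    with a show "a \<in> ?R" by (auto intro: exponents_add)
  next
    fix a assume a: "a \<in> ?R"
    then obtain i where i: "Poly_Mapping.lookup a i \<noteq> 0" by (metis DiffE insertI1 poly_mapping_eqI lookup_zero)
    with a have "i \<in> {1..n}" by (auto simp: in_exponents_iff)
    moreover have "a = Poly_Mapping.single i 1 + (a - Poly_Mapping.single i 1)"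
      using i by (intro poly_mapping_eqI) (auto simp: lookup_add lookup_minus lookup_single when_def)
    moreover have "a - Poly_Mapping.single i 1 \<in> exponents {1..n}"
      using a by (auto simp: in_exponents_iff lookup_minus)
    ultimately show "a \<in> ?L" by blast
  qed
  finally show ?thesis .
qed

section \<open>Depth of monomial quotients\<close>

declare One_nat_def [simp del]

lemmas expo_in_exponents' [simp] = expo_in_exponents[folded One_nat_def]

section \<open>Coefficients of products, restriction of supports, splitting of exponents\<close>

lemma lookup_monomial_mult:
  "Poly_Mapping.lookup (monomial d * p) c
    = (\<Sum>a\<in>Poly_Mapping.keys p. if d + a = c then Poly_Mapping.lookup p a else 0)"
proof -
  have "monomial d * p = monomial d * (\<Sum>a\<in>Poly_Mapping.keys p. Poly_Mapping.single a (Poly_Mapping.lookup p a))"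
    by (simp only: poly_sum_singles)
  also have "\<dots> = (\<Sum>a\<in>Poly_Mapping.keys p. Poly_Mapping.single (d + a) (Poly_Mapping.lookup p a))"
    by (simp add: sum_distrib_left monomial_def mult_single)
  finally show ?thesis by (simp add: lookup_sum lookup_single when_def)
qed

lemma lookup_monomial_mult_shift:
  "Poly_Mapping.lookup (monomial d * p) (d + a) = Poly_Mapping.lookup p a"
  by (simp add: lookup_monomial_mult sum.delta in_keys_iff)

definition restr :: "'a set \<Rightarrow> ('a \<Rightarrow>\<^sub>0 'b::comm_monoid_add) \<Rightarrow> ('a \<Rightarrow>\<^sub>0 'b)" where
  "restr C p = (\<Sum>a\<in>Poly_Mapping.keys p \<inter> C. Poly_Mapping.single a (Poly_Mapping.lookup p a))"

lemma lookup_restr: "Poly_Mapping.lookup (restr C p) a = (if a \<in> C then Poly_Mapping.lookup p a else 0)"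
  by (auto simp: restr_def lookup_sum lookup_single when_def sum.delta in_keys_iff)

lemma keys_restr: "Poly_Mapping.keys (restr C p) = Poly_Mapping.keys p \<inter> C"
  by (auto simp: in_keys_iff lookup_restr split: if_splits)

lemma exponent_split:
  assumes "a \<in> exponents V" "Poly_Mapping.lookup a i \<noteq> 0"
  shows "\<exists>b\<in>exponents V. a = Poly_Mapping.single i 1 + b"
  using assms
  by (intro bexI[of _ "a - Poly_Mapping.single i 1"] poly_mapping_eqI)
    (auto simp: in_exponents_iff lookup_add lookup_minus lookup_single when_def)

lemma exponent_nonzero: "a \<in> exponents V \<Longrightarrow> a \<noteq> 0 \<Longrightarrow> \<exists>i\<in>V. Poly_Mapping.lookup a i \<noteq> 0"
  by (fastforce simp: in_exponents_iff intro: poly_mapping_eqI)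

lemma single_eq_zero_iff [simp]: "Poly_Mapping.single i k = 0 \<longleftrightarrow> k = 0"
  by (auto dest: arg_cong[of _ _ "\<lambda>p. Poly_Mapping.lookup p i"])

lemma exponent_add_eq_zeroD: "a + b = (0 :: 'a \<Rightarrow>\<^sub>0 nat) \<Longrightarrow> a = 0"
  by (metis add_is_0 lookup_add lookup_zero poly_mapping_eqI)

lemma add_single_eq_update:
  "a + Poly_Mapping.single i k = Poly_Mapping.update i (Poly_Mapping.lookup a i + k) a"
  by (rule poly_mapping_eqI) (auto simp: lookup_add lookup_single lookup_update when_def)

lemma update_in_exponents: "a \<in> exponents V \<Longrightarrow> i \<in> V \<Longrightarrow> Poly_Mapping.update i k a \<in> exponents V"
  by (auto simp: in_exponents_iff lookup_update)

text \<open>The exponents of the monomials that span a Stanley space.\<close>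

definition cell :: "(nat \<Rightarrow>\<^sub>0 nat) \<Rightarrow> nat set \<Rightarrow> (nat \<Rightarrow>\<^sub>0 nat) set" where
  "cell m Z = (+) m ` exponents Z"

lemma cell_subset: "m \<in> exponents V \<Longrightarrow> Z \<subseteq> V \<Longrightarrow> cell m Z \<subseteq> exponents V"
  using exponents_mono[of Z V] by (auto simp: cell_def intro!: exponents_add)

section \<open>The quotient by a monomial ideal as a module\<close>

locale monomial_ideal =
  fixes n :: nat and A :: "(nat \<Rightarrow>\<^sub>0 nat) set" and I :: "'k::field mpoly set"
  assumes I_eq: "I = monomial_span A"
    and subset: "A \<subseteq> exponents {1..n}"
    and add_closed: "\<And>a b. a \<in> A \<Longrightarrow> b \<in> exponents {1..n} \<Longrightarrow> a + b \<in> A"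
begin

sublocale R: cring "S_ring n :: 'k mpoly ring" by (rule poly_ring_cring)

sublocale I: ideal I "S_ring n"
  unfolding I_eq by (rule monomial_span_ideal[OF subset add_closed])

sublocale M: Module.module "S_ring n" "quot_module (S_ring n) I"
  by (rule quot_module_is_module[OF R.is_cring I.is_ideal])

abbreviation S :: "'k mpoly ring" where "S \<equiv> S_ring n"
abbreviation M :: "('k mpoly, 'k mpoly set) module" where "M \<equiv> quot_module (S_ring n) I"
abbreviation cls :: "'k mpoly \<Rightarrow> 'k mpoly set" where "cls p \<equiv> I +>\<^bsub>S_ring n\<^esub> p"

lemma S_closed [simp]:
  "0 \<in> carrier S" "1 \<in> carrier S"
  "p \<in> carrier S \<Longrightarrow> q \<in> carrier S \<Longrightarrow> p + q \<in> carrier S"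
  "p \<in> carrier S \<Longrightarrow> q \<in> carrier S \<Longrightarrow> p - q \<in> carrier S"
  "p \<in> carrier S \<Longrightarrow> q \<in> carrier S \<Longrightarrow> p * q \<in> carrier S"
  "p \<in> carrier S \<Longrightarrow> - p \<in> carrier S"
  using R.one_closed R.a_closed[of p q] R.m_closed[of p q]
  by (simp_all add: carrier_poly_ring monomial_span_diff monomial_span_uminus)

lemma S_sum_closed [simp]: "(\<And>x. x \<in> X \<Longrightarrow> p x \<in> carrier S) \<Longrightarrow> sum p X \<in> carrier S"
  by (simp add: carrier_poly_ring monomial_span_sum)

lemma monomial_closed [simp]: "a \<in> exponents {1..n} \<Longrightarrow> monomial a \<in> carrier S"
  by (simp add: carrier_poly_ring)

lemma single_closed [simp]: "a \<in> exponents {1..n} \<Longrightarrow> Poly_Mapping.single a c \<in> carrier S"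
  by (simp add: carrier_poly_ring single_in_monomial_span)

lemma span_closed: "C \<subseteq> exponents {1..n} \<Longrightarrow> p \<in> monomial_span C \<Longrightarrow> p \<in> carrier S"
  using monomial_span_mono by (auto simp: carrier_poly_ring)

lemma I_mult: "p \<in> I \<Longrightarrow> q \<in> carrier S \<Longrightarrow> p * q \<in> I"
  using I.I_r_closed by simp

lemma I_add: "p \<in> I \<Longrightarrow> q \<in> I \<Longrightarrow> p + q \<in> I"
  by (simp add: I_eq monomial_span_add)

lemma I_diff: "p \<in> I \<Longrightarrow> q \<in> I \<Longrightarrow> p - q \<in> I"
  by (simp add: I_eq monomial_span_diff)

lemma I_lookup: "p \<in> I \<Longrightarrow> a \<notin> A \<Longrightarrow> Poly_Mapping.lookup p a = 0"
  unfolding I_eq by (rule monomial_span_lookup)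

lemma cls_eq_iff:
  assumes "p \<in> carrier S" "q \<in> carrier S"
  shows "cls p = cls q \<longleftrightarrow> p - q \<in> I"
  using R.quotient_eq_iff_same_a_r_cos[OF I.is_ideal assms] minus_poly_ring[OF assms] by simp

lemma carrier_M: "carrier M = cls ` carrier S"
  by (auto simp: quot_module_def FactRing_def A_RCOSETS_def')

lemma cls_closed [simp]: "p \<in> carrier S \<Longrightarrow> cls p \<in> carrier M"
  by (simp add: carrier_M)

lemma M_zero: "\<zero>\<^bsub>M\<^esub> = cls 0"
  using I.a_rcos_const[of 0] I.zero_closed by (simp add: quot_module_def FactRing_def)

lemma cls_eq_zero_iff: "p \<in> carrier S \<Longrightarrow> cls p = \<zero>\<^bsub>M\<^esub> \<longleftrightarrow> p \<in> I"
  by (simp add: M_zero cls_eq_iff)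

lemma M_add: "p \<in> carrier S \<Longrightarrow> q \<in> carrier S \<Longrightarrow> cls p \<oplus>\<^bsub>M\<^esub> cls q = cls (p + q)"
  using ring_hom_add[OF I.rcos_ring_hom, of p q] by (simp add: quot_module_def)

lemma M_smult: "p \<in> carrier S \<Longrightarrow> q \<in> carrier S \<Longrightarrow> p \<odot>\<^bsub>M\<^esub> cls q = cls (p * q)"
  using ring_hom_mult[OF I.rcos_ring_hom, of p q] by (simp add: quot_module_def)

lemma M_uminus: "p \<in> carrier S \<Longrightarrow> \<ominus>\<^bsub>M\<^esub> cls p = cls (- p)"
  by (intro M.M.minus_equality) (simp_all add: M_add M_zero)

lemma M_finsum:
  assumes "finite W" "\<And>w. w \<in> W \<Longrightarrow> p w \<in> carrier S"
  shows "(\<Oplus>\<^bsub>M\<^esub> w\<in>W. cls (p w)) = cls (\<Sum>w\<in>W. p w)"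
  using assms
proof (induction W rule: finite_induct)
  case empty
  show ?case by (simp add: M_zero)
next
  case (insert x F)
  then have "(\<Oplus>\<^bsub>M\<^esub> w\<in>insert x F. cls (p w)) = cls (p x) \<oplus>\<^bsub>M\<^esub> (\<Oplus>\<^bsub>M\<^esub> w\<in>F. cls (p w))"
    by (intro M.M.finsum_insert) auto
  with insert show ?case by (simp add: M_add)
qed

section \<open>Regular sequences on the quotient\<close>

lemma smult_in_ideal_smult:
  "a \<in> J \<Longrightarrow> u \<in> carrier M \<Longrightarrow> a \<odot>\<^bsub>M\<^esub> u \<in> ideal_smult S M J"
  unfolding ideal_smult_def by blast

lemma zero_in_ideal_smult: "\<zero>\<^bsub>M\<^esub> \<in> ideal_smult S M J"
proof -
  have "\<zero>\<^bsub>M\<^esub> \<in> N" if N: "submodule N S M" for N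
    using subgroup.one_closed[OF submodule.axioms(1)[OF N]] by simp
  then show ?thesis unfolding ideal_smult_def by blast
qed

text \<open>\<open>ideal_smult\<close> is an intersection of submodules, so one submodule that
  contains all products bounds it from above.\<close>

lemma ideal_smult_principal:
  assumes f: "f \<in> carrier S" and J: "J \<subseteq> (\<lambda>x. x * f) ` carrier S"
  shows "ideal_smult S M J \<subseteq> (\<lambda>v. cls (f * v)) ` carrier S" (is "_ \<subseteq> ?N")
proof -
  have "submodule ?N S M"
  proof (rule M.submoduleI)
    show "?N \<subseteq> carrier M" using f by auto
    show "\<zero>\<^bsub>M\<^esub> \<in> ?N" by (rule image_eqI[of _ _ 0]) (simp_all add: M_zero)
  next
    fix a assume "a \<in> ?N"
    then obtain v where "v \<in> carrier S" "a = cls (f * v)" by blast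
    then show "\<ominus>\<^bsub>M\<^esub> a \<in> ?N" using f by (intro image_eqI[of _ _ "- v"]) (simp_all add: M_uminus)
  next
    fix a b assume "a \<in> ?N" "b \<in> ?N"
    then obtain v w where "v \<in> carrier S" "a = cls (f * v)" "w \<in> carrier S" "b = cls (f * w)" by blast
    then show "a \<oplus>\<^bsub>M\<^esub> b \<in> ?N"
      using f by (intro image_eqI[of _ _ "v + w"]) (simp_all add: M_add distrib_left)
  next
    fix a x assume "a \<in> carrier S" "x \<in> ?N"
    then obtain v where "v \<in> carrier S" "x = cls (f * v)" "a \<in> carrier S" by blast
    then show "a \<odot>\<^bsub>M\<^esub> x \<in> ?N"
      using f by (intro image_eqI[of _ _ "a * v"]) (simp_all add: M_smult mult.left_commute)
  qed
  moreover have "{a \<odot>\<^bsub>M\<^esub> u | a u. a \<in> J \<and> u \<in> carrier M} \<subseteq> ?N"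
  proof clarify
    fix a u assume a: "a \<in> J" and u: "u \<in> carrier M"
    from a J obtain x where "a = x * f" "x \<in> carrier S" by blast
    moreover from u obtain p where "u = cls p" "p \<in> carrier S" unfolding carrier_M by blast
    ultimately show "a \<odot>\<^bsub>M\<^esub> u \<in> ?N"
      using f by (intro image_eqI[of _ _ "x * p"]) (simp_all add: M_smult mult.left_commute mult.assoc)
  qed
  ultimately show ?thesis unfolding ideal_smult_def by blast
qed

lemma ideal_smult_empty: "ideal_smult S M (Idl\<^bsub>S\<^esub> {}) \<subseteq> {\<zero>\<^bsub>M\<^esub>}"
proof -
  have "Idl\<^bsub>S\<^esub> {} \<subseteq> {0}" using R.genideal_minimal[OF R.zeroideal, of "{}"] by simp
  then have "Idl\<^bsub>S\<^esub> {} \<subseteq> (\<lambda>x. x * 0) ` carrier S" using S_closed(1) by auto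
  from ideal_smult_principal[OF S_closed(1) this] show ?thesis by (auto simp: M_zero)
qed

lemma ideal_smult_single:
  assumes f: "f \<in> carrier S"
  shows "ideal_smult S M (Idl\<^bsub>S\<^esub> {f}) \<subseteq> (\<lambda>v. cls (f * v)) ` carrier S"
proof (rule ideal_smult_principal[OF f])
  show "Idl\<^bsub>S\<^esub> {f} \<subseteq> (\<lambda>x. x * f) ` carrier S"
    unfolding R.cgenideal_eq_genideal[OF f, symmetric] cgenideal_def by auto
qed

text \<open>The elements before \<open>f\<close> generate the zero ideal, so \<open>f\<close> is a
  nonzerodivisor on the quotient itself.\<close>

lemma regular_sequence_first:
  assumes reg: "regular_sequence S M (f # xs)" and p: "p \<in> carrier S" "f * p \<in> I"
  shows "p \<in> I"
proof -
  have f: "f \<in> carrier S" using reg by (simp add: regular_sequence_def)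
  have "f \<odot>\<^bsub>M\<^esub> cls p = \<zero>\<^bsub>M\<^esub>" using f p by (simp add: M_smult cls_eq_zero_iff)
  then have "f \<odot>\<^bsub>M\<^esub> cls p \<in> ideal_smult S M (Idl\<^bsub>S\<^esub> {})" using zero_in_ideal_smult by simp
  moreover have "\<forall>i<length (f # xs). \<forall>u\<in>carrier M.
      (f # xs) ! i \<odot>\<^bsub>M\<^esub> u \<in> ideal_smult S M (Idl\<^bsub>S\<^esub> (set (take i (f # xs)))) \<longrightarrow>
      u \<in> ideal_smult S M (Idl\<^bsub>S\<^esub> (set (take i (f # xs))))"
    using reg unfolding regular_sequence_def by (elim conjE)
  from this[rule_format, of 0 "cls p"] have "f \<odot>\<^bsub>M\<^esub> cls p \<in> ideal_smult S M (Idl\<^bsub>S\<^esub> {})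
      \<Longrightarrow> cls p \<in> ideal_smult S M (Idl\<^bsub>S\<^esub> {})" using p by simp
  ultimately have "cls p \<in> ideal_smult S M (Idl\<^bsub>S\<^esub> {})" by blast
  then show ?thesis using ideal_smult_empty p cls_eq_zero_iff by blast
qed

text \<open>The elements before \<open>g\<close> generate \<open>(f)\<close>, which acts on the
  quotient by multiples of \<open>f\<close>; the condition is rewritten for representatives.\<close>

lemma regular_sequence_second:
  assumes reg: "regular_sequence S M (f # g # xs)"
    and p: "p \<in> carrier S" "v \<in> carrier S" "g * p - f * v \<in> I"
  shows "\<exists>w\<in>carrier S. p - f * w \<in> I"
proof -
  have fg: "f \<in> carrier S" "g \<in> carrier S" using reg by (simp_all add: regular_sequence_def)
  have "g \<odot>\<^bsub>M\<^esub> cls p = f \<odot>\<^bsub>M\<^esub> cls v" using fg p by (simp add: M_smult cls_eq_iff)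
  then have "g \<odot>\<^bsub>M\<^esub> cls p \<in> ideal_smult S M (Idl\<^bsub>S\<^esub> {f})"
    using smult_in_ideal_smult[of f "Idl\<^bsub>S\<^esub> {f}" "cls v"] R.genideal_self'[of f] fg p by simp
  moreover have "\<forall>i<length (f # g # xs). \<forall>u\<in>carrier M.
      (f # g # xs) ! i \<odot>\<^bsub>M\<^esub> u \<in> ideal_smult S M (Idl\<^bsub>S\<^esub> (set (take i (f # g # xs)))) \<longrightarrow>
      u \<in> ideal_smult S M (Idl\<^bsub>S\<^esub> (set (take i (f # g # xs))))"
    using reg unfolding regular_sequence_def by (elim conjE)
  from this[rule_format, of "Suc 0" "cls p"] have "g \<odot>\<^bsub>M\<^esub> cls p \<in> ideal_smult S M (Idl\<^bsub>S\<^esub> {f})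
      \<Longrightarrow> cls p \<in> ideal_smult S M (Idl\<^bsub>S\<^esub> {f})" using p by simp
  ultimately have "cls p \<in> ideal_smult S M (Idl\<^bsub>S\<^esub> {f})" by blast
  then obtain w where "w \<in> carrier S" "cls p = cls (f * w)" using ideal_smult_single[OF fg(1)] by blast
  then show ?thesis using fg p by (auto simp: cls_eq_iff)
qed

section \<open>Depth zero and positive depth\<close>

lemma max_ideal_closed: "f \<in> max_ideal n \<Longrightarrow> f \<in> carrier S"
  unfolding max_ideal_eq by (rule span_closed[of "exponents {1..n} - {0}"]) auto

text \<open>The class of the monomial \<open>u\<close> is nonzero and annihilated by the whole
  maximal ideal, so no element of that ideal can start a regular sequence.\<close>

lemma depth_eq_zero:
  assumes u: "u \<in> exponents {1..n} - A"
    and socle: "\<And>i. i \<in> {1..n} \<Longrightarrow> u + Poly_Mapping.single i 1 \<in> A"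
  shows "depth_quot n I = 0"
proof -
  have "xs = []" if xs: "set xs \<subseteq> max_ideal n" "regular_sequence S M xs" for xs
  proof (cases xs)
    case (Cons f ys)
    have "f * monomial u \<in> I"
      unfolding I_eq
    proof (rule monomial_span_mult)
      show "f \<in> monomial_span (exponents {1..n} - {0})" using xs Cons by (simp add: max_ideal_eq)
      show "monomial u \<in> monomial_span {u}" by simp
    next
      fix a b assume a: "a \<in> exponents {1..n} - {0}" and b: "b \<in> {u}"
      obtain i where i: "i \<in> {1..n}" "Poly_Mapping.lookup a i \<noteq> 0" using a exponent_nonzero by blast
      from exponent_split[OF _ i(2), of "{1..n}"] a obtain c
        where c: "c \<in> exponents {1..n}" "a = Poly_Mapping.single i 1 + c" by blast
      have "a + b = (u + Poly_Mapping.single i 1) + c" using b c by (simp add: ac_simps)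
      then show "a + b \<in> A" using add_closed[OF socle[OF i(1)] c(1)] by simp
    qed
    then have "monomial u \<in> I" using xs Cons u regular_sequence_first by auto
    then show ?thesis using u by (simp add: I_eq)
  qed simp
  then have "depth_quot n I \<le> 0"
    unfolding depth_quot_def depth_def by (intro SUP_least) (auto simp: zero_enat_def)
  then show ?thesis by simp
qed

text \<open>Among the terms of \<open>f\<close> that survive the inversion of a suitable
  \<open>x_i\<close>, one of highest degree in \<open>x_i\<close> gives, after multiplication by
  \<open>x_i\<close>, a term of the product that cannot cancel and lies outside of
  \<open>I\<close>.\<close>

lemma sum_variables_regular:
  assumes sat: "\<And>a. a \<in> exponents {1..n} - A \<Longrightarrow> \<exists>i\<in>{1..n}. \<forall>k. Poly_Mapping.update i k a \<notin> A"
    and f: "f \<in> carrier S" "(\<Sum>i\<in>{1..n}. var i) * f \<in> I"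
  shows "f \<in> I"
proof (rule ccontr)
  assume "f \<notin> I"
  then obtain a where a: "a \<in> Poly_Mapping.keys f" "a \<notin> A" by (auto simp: I_eq monomial_span_def)
  have E: "b \<in> exponents {1..n}" if "b \<in> Poly_Mapping.keys f" for b
    using f that by (auto simp: carrier_poly_ring monomial_span_def)
  obtain i where i: "i \<in> {1..n}" "\<And>k. Poly_Mapping.update i k a \<notin> A" using sat a E by blast
  define X where "X = {b \<in> Poly_Mapping.keys f. \<forall>k. Poly_Mapping.update i k b \<notin> A}"
  have X: "finite X" "X \<noteq> {}" using a i by (auto simp: X_def)
  have "Max ((\<lambda>b. Poly_Mapping.lookup b i) ` X) \<in> (\<lambda>b. Poly_Mapping.lookup b i) ` X"
    using X by (intro Max_in) auto
  then obtain b where bX: "b \<in> X" and bmax: "Max ((\<lambda>b. Poly_Mapping.lookup b i) ` X) = Poly_Mapping.lookup b i"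
    by blast
  have b: "b \<in> X" "\<And>c. c \<in> X \<Longrightarrow> Poly_Mapping.lookup c i \<le> Poly_Mapping.lookup b i"
    using bX X by (auto simp: bmax[symmetric])
  define c where "c = Poly_Mapping.single i 1 + b"
  \<comment> \<open>If \<open>x_j\<close> times the monomial of \<open>d\<close> is
    \<open>x_i\<close> times that of \<open>b\<close>, then \<open>d\<close> has a higher power of
    \<open>x_i\<close>. Multiplication by \<open>x_j\<close> carries the line through
    \<open>d\<close> in direction \<open>i\<close> to the one through \<open>b\<close>, so
    \<open>d\<close> lies in \<open>X\<close>, against the maximality of \<open>b\<close>.\<close>
  have other: "Poly_Mapping.lookup (var j * f) c = 0" if "j \<in> {1..n}" "j \<noteq> i" for j
    unfolding var_def lookup_monomial_mult
  proof (rule sum.neutral, safe)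
    fix d assume d: "d \<in> Poly_Mapping.keys f"
    show "(if Poly_Mapping.single j 1 + d = c then Poly_Mapping.lookup f d else 0) = 0"
    proof (cases "Poly_Mapping.single j 1 + d = c")
      case True
      then have lk: "Poly_Mapping.lookup (Poly_Mapping.single j 1 + d) x = Poly_Mapping.lookup c x" for x by simp
      have "Poly_Mapping.lookup d i = Poly_Mapping.lookup b i + 1"
        using lk[of i] that by (simp add: c_def lookup_add lookup_single)
      moreover have "Poly_Mapping.update i k d \<notin> A" for k
      proof
        assume "Poly_Mapping.update i k d \<in> A"
        then have "Poly_Mapping.update i k d + Poly_Mapping.single j 1 \<in> A" using that by (intro add_closed) auto
        moreover have "Poly_Mapping.update i k d + Poly_Mapping.single j 1 = Poly_Mapping.update i k b"
        proof (rule poly_mapping_eqI)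
          fix x
          show "Poly_Mapping.lookup (Poly_Mapping.update i k d + Poly_Mapping.single j 1) x
              = Poly_Mapping.lookup (Poly_Mapping.update i k b) x"
            using lk[of x] that by (auto simp: c_def lookup_add lookup_single lookup_update when_def)
        qed
        ultimately show False using b by (simp add: X_def)
      qed
      ultimately show ?thesis using b(2)[of d] d by (simp add: X_def)
    qed simp
  qed
  have "Poly_Mapping.lookup ((\<Sum>i\<in>{1..n}. var i) * f) c = (\<Sum>j\<in>{1..n}. Poly_Mapping.lookup (var j * f) c)"
    by (simp add: sum_distrib_right lookup_sum)
  also have "\<dots> = (\<Sum>j\<in>{i}. Poly_Mapping.lookup (var j * f) c)"
    using i other by (intro sum.mono_neutral_right) auto
  also have "\<dots> = Poly_Mapping.lookup f b" by (simp add: c_def var_def lookup_monomial_mult_shift)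
  finally have "Poly_Mapping.lookup ((\<Sum>i\<in>{1..n}. var i) * f) c \<noteq> 0" using b by (simp add: X_def in_keys_iff)
  then have "c \<in> A" using I_lookup[OF f(2)] by blast
  moreover have "c = Poly_Mapping.update i (Poly_Mapping.lookup b i + 1) b"
    using add_single_eq_update[of b i 1] by (simp add: c_def add.commute)
  ultimately show False using b by (simp add: X_def)
qed

text \<open>The sum of the variables forms a regular sequence. Its multiples do not exhaust the
  quotient: they have constant term 0, and so do the elements of \<open>I\<close>.\<close>

lemma depth_ge_one:
  assumes sat: "\<And>a. a \<in> exponents {1..n} - A \<Longrightarrow> \<exists>i\<in>{1..n}. \<forall>k. Poly_Mapping.update i k a \<notin> A"
    and proper: "0 \<notin> A"
  shows "1 \<le> depth_quot n I"
proof -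
  define l where "l = (\<Sum>i\<in>{1..n}. var i :: 'k mpoly)"
  have lm: "l \<in> monomial_span (exponents {1..n} - {0})"
    unfolding l_def var_def by (intro monomial_span_sum) auto
  then have l: "l \<in> carrier S" by (auto intro: span_closed)
  have "regular_sequence S M [l]"
    unfolding regular_sequence_def
  proof (intro conjI allI impI ballI)
    fix i u
    assume "i < length [l]" and u: "u \<in> carrier M"
      and lu: "[l] ! i \<odot>\<^bsub>M\<^esub> u \<in> ideal_smult S M (Idl\<^bsub>S\<^esub> (set (take i [l])))"
    then have i: "i = 0" by simp
    from u obtain f where f: "f \<in> carrier S" "u = cls f" by (auto simp: carrier_M)
    have "cls (l * f) = \<zero>\<^bsub>M\<^esub>" using lu i f l ideal_smult_empty by (auto simp: M_smult)
    then have "f \<in> I" using l f sum_variables_regular[OF sat, of f] by (simp add: cls_eq_zero_iff l_def)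
    then have "u = \<zero>\<^bsub>M\<^esub>" using f by (simp add: cls_eq_zero_iff)
    then show "u \<in> ideal_smult S M (Idl\<^bsub>S\<^esub> (set (take i [l])))" using zero_in_ideal_smult by simp
  next
    have "cls 1 \<notin> ideal_smult S M (Idl\<^bsub>S\<^esub> {l})"
    proof
      assume "cls 1 \<in> ideal_smult S M (Idl\<^bsub>S\<^esub> {l})"
      then obtain v where v: "v \<in> carrier S" "cls 1 = cls (l * v)" using ideal_smult_single[OF l] by blast
      then have "1 - l * v \<in> I" using l by (simp add: cls_eq_iff)
      from I_lookup[OF this proper] have "Poly_Mapping.lookup (l * v) 0 = (1 :: 'k)"
        by (simp add: lookup_minus)
      moreover have "l * v \<in> monomial_span (- {0})"
        by (rule monomial_span_mult[OF lm]) (use v in \<open>auto simp: carrier_poly_ring dest: exponent_add_eq_zeroD\<close>)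
      ultimately show False by (auto simp: monomial_span_def in_keys_iff)
    qed
    then have "ideal_smult S M (Idl\<^bsub>S\<^esub> {l}) \<noteq> carrier M" using cls_closed[OF S_closed(2)] by blast
    then show "ideal_smult S M (Idl\<^bsub>S\<^esub> (set [l])) \<noteq> carrier M" by simp
  next
    show "set [l] \<subseteq> carrier S" using l by simp
  qed
  then have "enat (length [l]) \<le> depth_quot n I"
    unfolding depth_quot_def depth_def using lm by (intro SUP_upper) (simp add: max_ideal_eq)
  then show ?thesis by (simp add: one_enat_def One_nat_def)
qed

end

section \<open>An obstruction to regular sequences of length two\<close>

context monomial_ideal
begin

text \<open>The map \<open>\<phi>\<close> below is linear modulo \<open>I\<close>. A regular
  sequence of length two would make it multiplication by some \<open>w\<close>, but \<open>p\<close>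
  forces the coefficient of \<open>w\<close> at \<open>u\<close> to be 0 and \<open>q\<close> forces
  it to be 1.\<close>

lemma depth_le_one:
  assumes u: "u \<in> exponents {1..n}" and PQ: "P \<union> Q = {1..n}"
    and mixed: "\<And>i j. i \<in> P \<Longrightarrow> j \<in> Q \<Longrightarrow>
      u + Poly_Mapping.single i 1 + Poly_Mapping.single j 1 \<in> A"
    and p: "p \<in> P - Q" "u + Poly_Mapping.single p 1 \<notin> A"
    and q: "q \<in> Q" "u + Poly_Mapping.single q 1 \<notin> A"
  shows "depth_quot n I \<le> 1"
proof -
  let ?m = "max_ideal n :: 'k mpoly set"
  \<comment> \<open>Terms with a variable outside of \<open>Q\<close> are discarded, which realises
    reduction modulo these variables.\<close>
  define \<epsilon> :: "'k mpoly \<Rightarrow> 'k mpoly" where "\<epsilon> h = restr (exponents Q) h" for h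
  define \<phi> where "\<phi> h = monomial u * \<epsilon> h" for h
  have QE: "exponents Q \<subseteq> exponents {1..n}" using PQ by (intro exponents_mono) auto
  have \<epsilon>: "\<epsilon> h \<in> monomial_span (exponents Q - {0})"
    "h - \<epsilon> h \<in> monomial_span (exponents {1..n} - exponents Q)" if "h \<in> ?m" for h
    using that
    by (auto simp: \<epsilon>_def max_ideal_eq monomial_span_def keys_restr in_keys_iff lookup_minus lookup_restr
        split: if_splits)
  have \<phi>_closed [simp]: "\<phi> h \<in> carrier S" if "h \<in> ?m" for h
  proof -
    have "\<epsilon> h \<in> carrier S" using QE by (intro span_closed[OF _ \<epsilon>(1)[OF that]]) auto
    then show ?thesis using u by (simp add: \<phi>_def)
  qed
  \<comment> \<open>A term of \<open>\<epsilon> f\<close> contains a variable in \<open>Q\<close>,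
    as \<open>f\<close> has no constant term, and a term of \<open>h - \<epsilon> h\<close> contains
    one outside of \<open>Q\<close>, hence in \<open>P\<close>. Together they carry \<open>u\<close>
    into \<open>A\<close>.\<close>
  have cross: "\<phi> f * (h - \<epsilon> h) \<in> I" if "f \<in> ?m" "h \<in> ?m" for f h
    unfolding I_eq \<phi>_def
  proof (rule monomial_span_mult)
    show "monomial u * \<epsilon> f \<in> monomial_span {u + a | a. a \<in> exponents Q - {0}}"
      by (rule monomial_span_mult[of _ "{u}", OF _ \<epsilon>(1)[OF that(1)]]) auto
    show "h - \<epsilon> h \<in> monomial_span (exponents {1..n} - exponents Q)" by (rule \<epsilon>(2)[OF that(2)])
  next
    fix x b assume "x \<in> {u + a | a. a \<in> exponents Q - {0}}" and b: "b \<in> exponents {1..n} - exponents Q"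
    then obtain a where a: "x = u + a" "a \<in> exponents Q" "a \<noteq> 0" by blast
    obtain j where j: "j \<in> Q" "Poly_Mapping.lookup a j \<noteq> 0" using a exponent_nonzero by blast
    obtain i where i: "i \<notin> Q" "Poly_Mapping.lookup b i \<noteq> 0" using b by (auto simp: in_exponents_iff)
    have "b \<in> exponents {1..n}" using b by (rule DiffD1)
    then have "\<forall>i. i \<notin> {1..n} \<longrightarrow> Poly_Mapping.lookup b i = 0" by (simp only: in_exponents_iff)
    with i(2) have "i \<in> {1..n}" by metis
    then have iP: "i \<in> P" using PQ i by blast
    from exponent_split[OF _ j(2), of "{1..n}"] a QE
    obtain a' where a': "a' \<in> exponents {1..n}" "a = Poly_Mapping.single j 1 + a'" by blast
    from exponent_split[OF _ i(2), of "{1..n}"] b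
    obtain b' where b': "b' \<in> exponents {1..n}" "b = Poly_Mapping.single i 1 + b'" by blast
    have "x + b = (u + Poly_Mapping.single i 1 + Poly_Mapping.single j 1) + (a' + b')"
      by (simp add: a a' b' ac_simps)
    then show "x + b \<in> A"
      using add_closed[OF mixed[OF iP j(1)] exponents_add[OF a'(1) b'(1)]] by simp
  qed
  have comm: "\<phi> f * h - \<phi> h * f \<in> I" if "f \<in> ?m" "h \<in> ?m" for f h
  proof -
    have "\<phi> f * h - \<phi> h * f = \<phi> f * (h - \<epsilon> h) - \<phi> h * (f - \<epsilon> f)"
      by (simp add: \<phi>_def algebra_simps)
    then show ?thesis using cross[OF that] cross[OF that(2,1)] by (simp add: I_diff)
  qed
  have var_in: "var i \<in> ?m" if "i \<in> {1..n}" for i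
    using that by (simp add: max_ideal_eq var_def)
  have "length xs \<le> 1" if xs: "set xs \<subseteq> ?m" "regular_sequence S M xs" for xs
  proof (rule ccontr)
    assume "\<not> length xs \<le> 1"
    then obtain f g ys where fg: "xs = f # g # ys"
      by (cases xs rule: remdups_adj.cases) auto
    then have fm: "f \<in> ?m" and gm: "g \<in> ?m" and reg: "regular_sequence S M (f # g # ys)"
      using xs by auto
    note fS = max_ideal_closed[OF fm]
    have "g * \<phi> f - f * \<phi> g \<in> I" using comm[OF fm gm] by (simp add: mult.commute)
    \<comment> \<open>\<open>g\<close> times \<open>\<phi> f\<close> is a multiple of
      \<open>f\<close> modulo \<open>I\<close>, hence so is \<open>\<phi> f\<close>, by regularity
      of \<open>g\<close> modulo \<open>f\<close>.\<close>
    then obtain w where w: "w \<in> carrier S" "\<phi> f - f * w \<in> I"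
      using regular_sequence_second[OF reg \<phi>_closed[OF fm] \<phi>_closed[OF gm]] by blast
    \<comment> \<open>Linearity gives the equation after multiplication by \<open>f\<close>, and
      \<open>f\<close> can be cancelled.\<close>
    have hom: "\<phi> h - h * w \<in> I" if h: "h \<in> ?m" for h
    proof -
      note hS = max_ideal_closed[OF h]
      have "f * (\<phi> h - h * w) = (\<phi> h * f - \<phi> f * h) + (\<phi> f - f * w) * h"
        by (simp add: algebra_simps)
      also have "\<dots> \<in> I" using comm[OF h fm] I_mult[OF w(2) hS] by (rule I_add)
      finally have mem: "f * (\<phi> h - h * w) \<in> I" .
      have "\<phi> h - h * w \<in> carrier S"
        by (intro S_closed(4) S_closed(5) \<phi>_closed h hS w(1))
      from regular_sequence_first[OF reg this mem] show ?thesis .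
    qed
    have "Poly_Mapping.lookup (\<phi> (var p) - var p * w) (u + Poly_Mapping.single p 1) = 0"
      using p PQ by (intro I_lookup[OF hom[OF var_in]]) auto
    moreover have "\<epsilon> (var p) = 0"
      unfolding \<epsilon>_def var_def monomial_def using p
      by (intro poly_mapping_eqI) (auto simp: lookup_restr lookup_single when_def in_exponents_iff split: if_splits)
    ultimately have w0: "Poly_Mapping.lookup w u = 0"
      using lookup_monomial_mult_shift[of "Poly_Mapping.single p 1" w u]
      by (simp add: \<phi>_def lookup_minus var_def add.commute)
    have "Poly_Mapping.lookup (\<phi> (var q) - var q * w) (u + Poly_Mapping.single q 1) = 0"
      using q PQ by (intro I_lookup[OF hom[OF var_in]]) auto
    moreover have "\<epsilon> (var q) = var q"
      unfolding \<epsilon>_def var_def monomial_def using q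
      by (intro poly_mapping_eqI) (auto simp: lookup_restr lookup_single when_def in_exponents_iff split: if_splits)
    moreover have "Poly_Mapping.lookup (var q * w) (u + Poly_Mapping.single q 1) = Poly_Mapping.lookup w u"
      unfolding var_def add.commute[of u] by (rule lookup_monomial_mult_shift)
    moreover have "Poly_Mapping.lookup (monomial u * (var q :: 'k mpoly)) (u + Poly_Mapping.single q 1) = 1"
      unfolding lookup_monomial_mult_shift by (simp add: var_def monomial_def)
    ultimately show False using w0 by (simp add: \<phi>_def lookup_minus)
  qed
  then show ?thesis
    unfolding depth_quot_def depth_def by (intro SUP_least) (auto simp: one_enat_def)
qed

section \<open>Stanley decompositions of monomial quotients\<close>

lemma monomial_combination_eq:
  assumes m: "m \<in> exponents {1..n}" and Z: "Z \<subseteq> {1..n}" and W: "finite W" "W \<subseteq> exponents Z"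
  shows "monomial_combination n I m W c = cls (\<Sum>w\<in>W. Poly_Mapping.single (m + w) (c w))"
proof -
  have mw: "m + w \<in> exponents {1..n}" if "w \<in> W" for w
    using m W exponents_mono[OF Z] that by (intro exponents_add) auto
  have "const (c w) \<odot>\<^bsub>M\<^esub> cls (monomial m * monomial w) = cls (Poly_Mapping.single (m + w) (c w))"
    if "w \<in> W" for w
  proof -
    have "const (c w) \<in> carrier S" by (simp add: const_def)
    moreover have "monomial m * monomial w = (monomial (m + w) :: 'k mpoly)"
      by (simp add: monomial_def mult_single)
    ultimately show ?thesis
      using mw[OF that] by (simp add: M_smult) (simp add: const_def monomial_def mult_single)
  qed
  then have "monomial_combination n I m W c = (\<Oplus>\<^bsub>M\<^esub> w\<in>W. cls (Poly_Mapping.single (m + w) (c w)))"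
    unfolding monomial_combination_def using mw by (intro M.M.finsum_cong') auto
  also have "\<dots> = cls (\<Sum>w\<in>W. Poly_Mapping.single (m + w) (c w))"
    using W mw by (intro M_finsum) auto
  finally show ?thesis .
qed

lemma stanley_space_eq:
  assumes m: "m \<in> exponents {1..n}" and Z: "Z \<subseteq> {1..n}"
  shows "stanley_space n I m Z = cls ` monomial_span (cell m Z)"
proof (intro equalityI subsetI)
  fix x assume "x \<in> stanley_space n I m Z"
  then obtain W c where W: "finite W" "W \<subseteq> exponents Z" "x = monomial_combination n I m W c"
    by (auto simp: stanley_space_def)
  have "(\<Sum>w\<in>W. Poly_Mapping.single (m + w) (c w)) \<in> monomial_span (cell m Z)"
    using W by (intro monomial_span_sum single_in_monomial_span) (auto simp: cell_def)
  with W show "x \<in> cls ` monomial_span (cell m Z)" by (simp add: monomial_combination_eq[OF m Z])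
next
  fix x assume "x \<in> cls ` monomial_span (cell m Z)"
  then obtain p where p: "x = cls p" "Poly_Mapping.keys p \<subseteq> cell m Z" by (auto simp: monomial_span_def)
  define W where "W = {w \<in> exponents Z. m + w \<in> Poly_Mapping.keys p}"
  have img: "(+) m ` W = Poly_Mapping.keys p" using p by (auto simp: W_def cell_def)
  have fin: "finite W" by (rule finite_imageD[of "(+) m"]) (auto simp: img)
  have WZ: "W \<subseteq> exponents Z" by (auto simp: W_def)
  have "(\<Sum>w\<in>W. Poly_Mapping.single (m + w) (Poly_Mapping.lookup p (m + w)))
      = (\<Sum>a\<in>(+) m ` W. Poly_Mapping.single a (Poly_Mapping.lookup p a))"
    by (subst sum.reindex) auto
  then have "x = monomial_combination n I m W (\<lambda>w. Poly_Mapping.lookup p (m + w))"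
    unfolding monomial_combination_eq[OF m Z fin WZ] by (simp add: p(1) img poly_sum_singles)
  then show "x \<in> stanley_space n I m Z" using fin WZ unfolding stanley_space_def by blast
qed

text \<open>Monomials in \<open>I\<close> have class 0, whereas distinct monomials outside of
  \<open>I\<close> have linearly independent classes.\<close>

lemma stanley_independent_iff:
  assumes m: "m \<in> exponents {1..n}" and Z: "Z \<subseteq> {1..n}"
  shows "stanley_independent n I m Z \<longleftrightarrow> cell m Z \<inter> A = {}"
proof
  assume ind: "stanley_independent n I m Z"
  show "cell m Z \<inter> A = {}"
  proof (rule ccontr)
    assume "cell m Z \<inter> A \<noteq> {}"
    then obtain w where w: "w \<in> exponents Z" "m + w \<in> A" by (auto simp: cell_def)
    have "Poly_Mapping.single (m + w) 1 \<in> I" using w by (simp add: I_eq single_in_monomial_span)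
    then have "monomial_combination n I m {w} (\<lambda>_. 1) = \<zero>\<^bsub>M\<^esub>"
      using w subset by (subst monomial_combination_eq[OF m Z]) (auto simp: cls_eq_zero_iff)
    then show False using ind[unfolded stanley_independent_def, rule_format, of "{w}" "\<lambda>_. 1" w] w by auto
  qed
next
  assume disj: "cell m Z \<inter> A = {}"
  show "stanley_independent n I m Z"
    unfolding stanley_independent_def
  proof (intro allI impI ballI)
    fix W :: "(nat \<Rightarrow>\<^sub>0 nat) set" and c :: "(nat \<Rightarrow>\<^sub>0 nat) \<Rightarrow> 'k" and w
    assume W: "finite W \<and> W \<subseteq> exponents Z \<and> monomial_combination n I m W c = \<zero>\<^bsub>M\<^esub>" and w: "w \<in> W"
    define s where "s = (\<Sum>w\<in>W. Poly_Mapping.single (m + w) (c w))"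
    have "s \<in> carrier S"
      unfolding s_def using m W exponents_mono[OF Z] by (intro S_sum_closed single_closed exponents_add) auto
    moreover have "cls s = \<zero>\<^bsub>M\<^esub>" using W monomial_combination_eq[OF m Z, of W c] by (simp add: s_def)
    ultimately have "s \<in> I" by (simp add: cls_eq_zero_iff)
    moreover have "m + w \<notin> A" using disj w W by (auto simp: cell_def)
    ultimately have "Poly_Mapping.lookup s (m + w) = 0" by (rule I_lookup)
    moreover have "Poly_Mapping.lookup s (m + w) = (\<Sum>v\<in>W. if v = w then c v else 0)"
      unfolding s_def lookup_sum by (intro sum.cong) (auto simp: lookup_single when_def)
    ultimately show "c w = 0" using W w by (simp add: sum.delta)
  qed
qed

text \<open>The summands of the class of the monomial \<open>u\<close> lift to polynomials supported
  on the cells. Their sum has coefficient 1 at \<open>u\<close>, so \<open>u\<close> lies in one of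
  the cells.\<close>

lemma stanley_decomposition_covers:
  assumes D: "stanley_decomposition n I D" and u: "u \<in> exponents {1..n} - A"
  shows "\<exists>m Z. (m, Z) \<in> set D \<and> u \<in> cell m Z \<and> Z \<subseteq> {1..n} \<and> cell m Z \<inter> A = {}"
proof -
  have D1: "m \<in> exponents {1..n}" "Z \<subseteq> {1..n}" "cell m Z \<inter> A = {}" if "(m, Z) \<in> set D" for m Z
  proof -
    have "m \<in> exponents {1..n} \<and> Z \<subseteq> {1..n} \<and> stanley_independent n I m Z"
      using D that unfolding stanley_decomposition_def by blast
    then show "m \<in> exponents {1..n}" "Z \<subseteq> {1..n}" "cell m Z \<inter> A = {}"
      using stanley_independent_iff[of m Z] by simp_all
  qed
  let ?V = "\<lambda>i. stanley_space n I (fst (D ! i)) (snd (D ! i))"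
  have sub: "fst (D ! i) \<in> exponents {1..n}" "snd (D ! i) \<subseteq> {1..n}" if "i < length D" for i
    using D1[of "fst (D ! i)" "snd (D ! i)"] that by auto
  have "\<forall>x\<in>carrier M. \<exists>!f. f \<in> (\<Pi>\<^sub>E i\<in>{..<length D}. ?V i) \<and> x = (\<Oplus>\<^bsub>M\<^esub> i\<in>{..<length D}. f i)"
    using D unfolding stanley_decomposition_def internal_direct_sum_def by (elim conjE)
  moreover have "cls (monomial u) \<in> carrier M" using u by simp
  ultimately have "\<exists>!f. f \<in> (\<Pi>\<^sub>E i\<in>{..<length D}. ?V i) \<and>
      cls (monomial u) = (\<Oplus>\<^bsub>M\<^esub> i\<in>{..<length D}. f i)" by (rule bspec)
  then obtain f where f: "f \<in> (\<Pi>\<^sub>E i\<in>{..<length D}. ?V i)"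
      "cls (monomial u) = (\<Oplus>\<^bsub>M\<^esub> i\<in>{..<length D}. f i)"
    by (elim ex1E conjE)
  have "\<forall>i<length D. \<exists>p\<in>monomial_span (cell (fst (D ! i)) (snd (D ! i))). f i = cls p"
  proof (intro allI impI)
    fix i assume i: "i < length D"
    then have "f i \<in> ?V i" using f(1) by auto
    then show "\<exists>p\<in>monomial_span (cell (fst (D ! i)) (snd (D ! i))). f i = cls p"
      unfolding stanley_space_eq[OF sub[OF i]] by blast
  qed
  then obtain p where p: "\<And>i. i < length D \<Longrightarrow> p i \<in> monomial_span (cell (fst (D ! i)) (snd (D ! i)))"
      "\<And>i. i < length D \<Longrightarrow> f i = cls (p i)" by metis
  have pS: "p i \<in> carrier S" if "i < length D" for i
    using span_closed[OF cell_subset[OF sub[OF that]] p(1)[OF that]] .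
  have "(\<Oplus>\<^bsub>M\<^esub> i\<in>{..<length D}. f i) = (\<Oplus>\<^bsub>M\<^esub> i\<in>{..<length D}. cls (p i))"
    using p pS by (intro M.M.finsum_cong') auto
  also have "\<dots> = cls (\<Sum>i<length D. p i)" using pS by (intro M_finsum) auto
  finally have "cls (monomial u) = cls (\<Sum>i<length D. p i)" using f(2) by simp
  moreover have "(\<Sum>i<length D. p i) \<in> carrier S" using pS by (intro S_sum_closed) auto
  ultimately have "monomial u - (\<Sum>i<length D. p i) \<in> I"
    using u by (subst cls_eq_iff[symmetric]) auto
  then have "Poly_Mapping.lookup (monomial u - (\<Sum>i<length D. p i)) u = 0"
    using u by (intro I_lookup) auto
  then have "Poly_Mapping.lookup (\<Sum>i<length D. p i) u = 1"
    by (simp add: lookup_minus monomial_def)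
  then have "\<exists>i<length D. Poly_Mapping.lookup (p i) u \<noteq> 0"
    unfolding lookup_sum by (metis lessThan_iff sum.neutral zero_neq_one)
  then obtain i where i: "i < length D" "u \<in> Poly_Mapping.keys (p i)" by (auto simp: in_keys_iff)
  then have "u \<in> cell (fst (D ! i)) (snd (D ! i))" using p(1) by (auto simp: monomial_span_def)
  moreover have mem: "(fst (D ! i), snd (D ! i)) \<in> set D" using i by simp
  ultimately show ?thesis using D1[OF mem] by blast
qed

text \<open>A partition of the complement of \<open>A\<close> into cells splits a polynomial by its
  support. Uniqueness is read off from coefficients, as the cells are disjoint and avoid
  \<open>A\<close>.\<close>

lemma stanley_decompositionI:
  assumes D: "\<And>m Z. (m, Z) \<in> set D \<Longrightarrow> m \<in> exponents {1..n} \<and> Z \<subseteq> {1..n} \<and> cell m Z \<inter> A = {}"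
    and disj: "\<And>i j. i < length D \<Longrightarrow> j < length D \<Longrightarrow> i \<noteq> j \<Longrightarrow>
      cell (fst (D ! i)) (snd (D ! i)) \<inter> cell (fst (D ! j)) (snd (D ! j)) = {}"
    and cover: "exponents {1..n} - A \<subseteq> (\<Union>(m, Z)\<in>set D. cell m Z)"
  shows "stanley_decomposition n I D"
proof -
  define N where "N = length D"
  define C where "C i = cell (fst (D ! i)) (snd (D ! i))" for i
  have sub: "fst (D ! i) \<in> exponents {1..n}" "snd (D ! i) \<subseteq> {1..n}" "C i \<inter> A = {}" if "i < N" for i
    using D[of "fst (D ! i)" "snd (D ! i)"] that by (auto simp: N_def C_def)
  have CE: "C i \<subseteq> exponents {1..n}" if "i < N" for i
    unfolding C_def using sub[OF that] by (intro cell_subset)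
  have disjC: "C i \<inter> C j = {}" if "i < N" "j < N" "i \<noteq> j" for i j
    using disj that by (simp add: N_def C_def)
  have coverC: "\<exists>i<N. a \<in> C i" if a: "a \<in> exponents {1..n}" "a \<notin> A" for a
  proof -
    have "a \<in> (\<Union>(m, Z)\<in>set D. cell m Z)" using a by (intro subsetD[OF cover]) simp
    then obtain m Z where mZ: "(m, Z) \<in> set D" "a \<in> cell m Z" by blast
    then obtain i where "i < length D" "D ! i = (m, Z)" by (auto simp: in_set_conv_nth)
    then show ?thesis using mZ by (auto simp: N_def C_def)
  qed
  let ?V = "\<lambda>i. stanley_space n I (fst (D ! i)) (snd (D ! i))"
  have V: "?V i = cls ` monomial_span (C i)" if "i < N" for i
    unfolding C_def by (rule stanley_space_eq[OF sub(1,2)[OF that]])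
  have span_S: "p \<in> carrier S" if "i < N" "p \<in> monomial_span (C i)" for i p
    by (rule span_closed[OF CE[OF that(1)] that(2)])
  have ex: "\<exists>f \<in> (\<Pi>\<^sub>E i\<in>{..<N}. ?V i). x = (\<Oplus>\<^bsub>M\<^esub> i\<in>{..<N}. f i)" if x: "x \<in> carrier M" for x
  proof -
    obtain p where p: "p \<in> carrier S" "x = cls p" using x carrier_M by auto
    \<comment> \<open>Terms with exponent in \<open>A\<close> belong to no cell; they vanish in the
      quotient.\<close>
    define f where "f = (\<lambda>i\<in>{..<N}. cls (restr (C i) p))"
    have r: "restr (C i) p \<in> monomial_span (C i)" for i by (auto simp: monomial_span_def keys_restr)
    then have rS: "restr (C i) p \<in> carrier S" if "i < N" for i using span_S[OF that] by blast
    have fV: "f \<in> (\<Pi>\<^sub>E i\<in>{..<N}. ?V i)"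
    proof (rule PiE_I)
      fix i assume "i \<in> {..<N}"
      then have i: "i < N" by simp
      show "f i \<in> ?V i" unfolding V[OF i] using r i by (simp add: f_def)
    qed (simp add: f_def)
    have "(\<Oplus>\<^bsub>M\<^esub> i\<in>{..<N}. f i) = (\<Oplus>\<^bsub>M\<^esub> i\<in>{..<N}. cls (restr (C i) p))"
      using rS by (intro M.M.finsum_cong') (auto simp: f_def)
    also have "\<dots> = cls (\<Sum>i<N. restr (C i) p)" using rS by (intro M_finsum) auto
    finally have fsum: "(\<Oplus>\<^bsub>M\<^esub> i\<in>{..<N}. f i) = cls (\<Sum>i<N. restr (C i) p)" .
    have "p - (\<Sum>i<N. restr (C i) p) \<in> I"
      unfolding I_eq monomial_span_def
    proof (intro CollectI subsetI)
      fix a assume a: "a \<in> Poly_Mapping.keys (p - (\<Sum>i<N. restr (C i) p))"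
      show "a \<in> A"
      proof (rule ccontr)
        assume aA: "a \<notin> A"
        have lk: "Poly_Mapping.lookup (\<Sum>i<N. restr (C i) p) a
            = (\<Sum>i<N. if a \<in> C i then Poly_Mapping.lookup p a else 0)"
          by (simp add: lookup_sum lookup_restr)
        show False
        proof (cases "a \<in> exponents {1..n}")
          case True
          with coverC aA obtain i where i: "i < N" "a \<in> C i" by blast
          have "(\<Sum>j<N. if a \<in> C j then Poly_Mapping.lookup p a else 0)
              = (\<Sum>j<N. if j = i then Poly_Mapping.lookup p a else 0)"
            using i disjC by (intro sum.cong) auto
          then have "Poly_Mapping.lookup (p - (\<Sum>i<N. restr (C i) p)) a = 0"
            using i by (simp add: lookup_minus lk sum.delta)
          then show False using a by (simp add: in_keys_iff)
        next
          case False
          then have "a \<notin> C i" if "i < N" for i using CE[OF that] by blast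
          then have "Poly_Mapping.lookup (\<Sum>i<N. restr (C i) p) a = 0" by (simp add: lk)
          moreover have "Poly_Mapping.lookup p a = 0"
            using p(1) False by (auto simp: carrier_poly_ring monomial_span_def in_keys_iff)
          ultimately show False using a by (simp add: in_keys_iff lookup_minus)
        qed
      qed
    qed
    moreover have "(\<Sum>i<N. restr (C i) p) \<in> carrier S" using rS by (intro S_sum_closed) auto
    ultimately have "cls p = cls (\<Sum>i<N. restr (C i) p)" using p cls_eq_iff by blast
    with p fsum have "x = (\<Oplus>\<^bsub>M\<^esub> i\<in>{..<N}. f i)" by simp
    from this fV show ?thesis by (rule bexI)
  qed
  have unique: "f = g"
    if f: "f \<in> (\<Pi>\<^sub>E i\<in>{..<N}. ?V i)" and g: "g \<in> (\<Pi>\<^sub>E i\<in>{..<N}. ?V i)"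
      and eq: "(\<Oplus>\<^bsub>M\<^esub> i\<in>{..<N}. f i) = (\<Oplus>\<^bsub>M\<^esub> i\<in>{..<N}. g i)" for f g
  proof -
    have rep: "\<exists>p. \<forall>i<N. p i \<in> monomial_span (C i) \<and> h i = cls (p i)"
      if h: "h \<in> (\<Pi>\<^sub>E i\<in>{..<N}. ?V i)" for h
    proof -
      have "\<forall>i<N. \<exists>p. p \<in> monomial_span (C i) \<and> h i = cls p"
      proof (intro allI impI)
        fix i assume i: "i < N"
        then have "h i \<in> ?V i" using h by auto
        then show "\<exists>p. p \<in> monomial_span (C i) \<and> h i = cls p" unfolding V[OF i] by blast
      qed
      then show ?thesis by metis
    qed
    have sum_rep: "(\<Oplus>\<^bsub>M\<^esub> i\<in>{..<N}. h i) = cls (\<Sum>i<N. p i)"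
      if h: "\<forall>i<N. p i \<in> monomial_span (C i) \<and> h i = cls (p i)" for h p
    proof -
      have pS: "p i \<in> carrier S" if "i < N" for i using h span_S[OF that] that by blast
      have "(\<Oplus>\<^bsub>M\<^esub> i\<in>{..<N}. h i) = (\<Oplus>\<^bsub>M\<^esub> i\<in>{..<N}. cls (p i))"
        using h pS by (intro M.M.finsum_cong') auto
      also have "\<dots> = cls (\<Sum>i<N. p i)" using pS by (intro M_finsum) auto
      finally show ?thesis .
    qed
    obtain p where p: "\<forall>i<N. p i \<in> monomial_span (C i) \<and> f i = cls (p i)" using rep[OF f] by blast
    obtain q where q: "\<forall>i<N. q i \<in> monomial_span (C i) \<and> g i = cls (q i)" using rep[OF g] by blast
    have "(\<Sum>i<N. p i) \<in> carrier S" "(\<Sum>i<N. q i) \<in> carrier S"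
      using p q span_S by (auto intro!: S_sum_closed)
    then have "(\<Sum>i<N. p i) - (\<Sum>i<N. q i) \<in> I"
      using eq sum_rep[OF p] sum_rep[OF q] cls_eq_iff by simp
    then have dI: "(\<Sum>i<N. p i - q i) \<in> I" by (simp add: sum_subtractf)
    have "p i = q i" if i: "i < N" for i
    proof (rule poly_mapping_eqI)
      fix a
      have zero: "Poly_Mapping.lookup (p j) a = 0 \<and> Poly_Mapping.lookup (q j) a = 0"
        if "j < N" "a \<notin> C j" for j
        using p q that monomial_span_lookup by blast
      show "Poly_Mapping.lookup (p i) a = Poly_Mapping.lookup (q i) a"
      proof (cases "a \<in> C i")
        case True
        then have "a \<notin> A" using sub(3)[OF i] by blast
        from I_lookup[OF dI this]
        have "(\<Sum>j<N. Poly_Mapping.lookup (p j) a - Poly_Mapping.lookup (q j) a) = 0"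
          by (simp add: lookup_sum lookup_minus)
        moreover have "(\<Sum>j<N. Poly_Mapping.lookup (p j) a - Poly_Mapping.lookup (q j) a)
            = (\<Sum>j<N. if j = i then Poly_Mapping.lookup (p i) a - Poly_Mapping.lookup (q i) a else 0)"
        proof (intro sum.cong refl)
          fix j assume j: "j \<in> {..<N}"
          then have "j \<noteq> i \<Longrightarrow> a \<notin> C j" using disjC[OF _ i, of j] True by blast
          then show "Poly_Mapping.lookup (p j) a - Poly_Mapping.lookup (q j) a
              = (if j = i then Poly_Mapping.lookup (p i) a - Poly_Mapping.lookup (q i) a else 0)"
            using zero[of j] j by simp
        qed
        ultimately show ?thesis using i by (simp add: sum.delta)
      next
        case False
        then show ?thesis using zero[OF i] by simp
      qed
    qed
    then have "f i = g i" if "i < N" for i using p q that by simp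
    then show "f = g" by (intro PiE_ext[OF f g]) simp
  qed
  have "internal_direct_sum M N ?V"
    unfolding internal_direct_sum_def
  proof (intro conjI allI impI ballI)
    fix i assume i: "i < N"
    show "?V i \<subseteq> carrier M" unfolding V[OF i] using span_S[OF i] by auto
  next
    fix x assume x: "x \<in> carrier M"
    from ex[OF x] obtain f where f: "f \<in> (\<Pi>\<^sub>E i\<in>{..<N}. ?V i)" "x = (\<Oplus>\<^bsub>M\<^esub> i\<in>{..<N}. f i)"
      by (rule bexE)
    show "\<exists>!f. f \<in> (\<Pi>\<^sub>E i\<in>{..<N}. ?V i) \<and> x = (\<Oplus>\<^bsub>M\<^esub> i\<in>{..<N}. f i)"
    proof (rule ex1I[of _ f])
      show "f \<in> (\<Pi>\<^sub>E i\<in>{..<N}. ?V i) \<and> x = (\<Oplus>\<^bsub>M\<^esub> i\<in>{..<N}. f i)"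
        using f by (rule conjI)
      fix g assume g: "g \<in> (\<Pi>\<^sub>E i\<in>{..<N}. ?V i) \<and> x = (\<Oplus>\<^bsub>M\<^esub> i\<in>{..<N}. g i)"
      show "g = f"
        by (rule unique[OF conjunct1[OF g] f(1) trans[OF sym[OF conjunct2[OF g]] f(2)]])
    qed
  qed
  moreover have "\<forall>(m, Z)\<in>set D. m \<in> exponents {1..n} \<and> Z \<subseteq> {1..n} \<and> stanley_independent n I m Z"
  proof clarify
    fix m Z assume "(m, Z) \<in> set D"
    with D[OF this] show "m \<in> exponents {1..n} \<and> Z \<subseteq> {1..n} \<and> stanley_independent n I m Z"
      using stanley_independent_iff[of m Z] by simp
  qed
  ultimately show ?thesis unfolding stanley_decomposition_def N_def by blast
qed

end

section \<open>A Stanley decomposition into truncation classes and rays\<close>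

lemma finite_bounded_exponents:
  "finite {a \<in> exponents {1..n}. \<forall>i. Poly_Mapping.lookup a i \<le> g}" (is "finite ?B")
proof (rule finite_imageD)
  let ?F = "{f :: nat \<Rightarrow> nat. \<forall>x. (x \<in> {1..n} \<longrightarrow> f x \<in> {..g}) \<and> (x \<notin> {1..n} \<longrightarrow> f x = 0)}"
  have "finite ?F" by (rule finite_set_of_finite_funs) auto
  then show "finite (Poly_Mapping.lookup ` ?B)"
    by (rule rev_finite_subset) (auto simp: in_exponents_iff)
  show "inj_on Poly_Mapping.lookup ?B" by (auto intro!: inj_onI poly_mapping_eqI)
qed

lemma exponents_outside: "a \<in> exponents V \<Longrightarrow> i \<notin> V \<Longrightarrow> Poly_Mapping.lookup a i = 0"
  by (simp add: in_exponents_iff)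

lemma lookup_trunc:
  "a \<in> exponents {1..n} \<Longrightarrow> Poly_Mapping.lookup (trunc n g a) i = min (Poly_Mapping.lookup a i) g"
  by (cases i) (auto simp: trunc_def lookup_expo in_exponents_iff)

lemma trunc_in_exponents [simp]: "trunc n g a \<in> exponents {1..n}"
  by (simp add: trunc_def)

lemma exponent_leE:
  assumes "a \<in> exponents V" "b \<in> exponents V" "\<And>i. Poly_Mapping.lookup a i \<le> Poly_Mapping.lookup b i"
  shows "\<exists>c\<in>exponents V. b = a + c"
  using assms
  by (intro bexI[of _ "b - a"] poly_mapping_eqI) (auto simp: in_exponents_iff lookup_add lookup_minus)

text \<open>Membership is decided by exponents cut off at \<open>g\<close>, which leaves finitely
  many cases. For powers of path ideals \<open>g\<close> is the exponent \<open>t\<close> of the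
  power.\<close>

locale bounded_monomial_ideal = monomial_ideal n A I
  for n A and I :: "'k::field mpoly set" +
  fixes g :: nat
  assumes trunc_iff: "\<And>a. a \<in> exponents {1..n} \<Longrightarrow> trunc n g a \<in> A \<longleftrightarrow> a \<in> A"
    and proper: "0 \<notin> A"
begin

text \<open>The monomial stays outside of \<open>I\<close> when the variable \<open>x_i\<close> is
  inverted.\<close>

definition free :: "nat \<Rightarrow> (nat \<Rightarrow>\<^sub>0 nat) \<Rightarrow> bool" where
  "free i a \<longleftrightarrow> (\<forall>k. Poly_Mapping.update i k a \<notin> A)"

definition first_free :: "nat \<Rightarrow> (nat \<Rightarrow>\<^sub>0 nat) \<Rightarrow> bool" where
  "first_free i a \<longleftrightarrow> i \<in> {1..n} \<and> free i a \<and> (\<forall>j\<in>{1..<i}. \<not> free j a)"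

text \<open>The truncation class of such a point is the point itself or, if its entry
  \<open>i\<close> reaches \<open>g\<close>, a half line in direction \<open>i\<close>. These
  classes are the ones to be glued.\<close>

definition ray :: "nat \<Rightarrow> (nat \<Rightarrow>\<^sub>0 nat) \<Rightarrow> bool" where
  "ray i a \<longleftrightarrow> first_free i a \<and> (\<forall>j\<in>{1..n} - {i}. Poly_Mapping.lookup a j < g)"

text \<open>
  The classes of exponents with the same truncation at \<open>g\<close> give a Stanley decomposition, but a
  class with all entries below \<open>g\<close> is a single point. Such a point is put, together with all
  points that lie on a line in the direction of its first free variable, into a ray.
\<close>

definition rep :: "(nat \<Rightarrow>\<^sub>0 nat) \<Rightarrow> (nat \<Rightarrow>\<^sub>0 nat) \<times> nat set" where
  "rep a = (if \<exists>i. ray i a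
     then (let i = (THE i. ray i a) in
       (Poly_Mapping.update i (LEAST k. first_free i (Poly_Mapping.update i k a)) a, {i}))
     else (trunc n g a, {i \<in> {1..n}. g \<le> Poly_Mapping.lookup a i}))"

lemma update_update: "Poly_Mapping.update i k (Poly_Mapping.update i l a) = Poly_Mapping.update i k a"
  by (rule poly_mapping_eqI) (simp add: lookup_update)

lemma update_same: "Poly_Mapping.update i (Poly_Mapping.lookup a i) a = a"
  by (rule poly_mapping_eqI) (simp add: lookup_update)

lemma A_mono:
  assumes "a \<in> A" "b \<in> exponents {1..n}" "\<And>i. Poly_Mapping.lookup a i \<le> Poly_Mapping.lookup b i"
  shows "b \<in> A"
  using exponent_leE[OF _ assms(2,3)] add_closed[OF assms(1)] assms(1) subset by blast

lemma free_notin: "free i a \<Longrightarrow> a \<notin> A"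
  unfolding free_def by (metis update_same)

lemma free_antimono:
  assumes "free j b" "a \<in> exponents {1..n}" "b \<in> exponents {1..n}" "j \<in> {1..n}"
    "\<And>i. Poly_Mapping.lookup a i \<le> Poly_Mapping.lookup b i"
  shows "free j a"
  unfolding free_def
proof
  fix k
  show "Poly_Mapping.update j k a \<notin> A"
  proof
    assume "Poly_Mapping.update j k a \<in> A"
    then have "Poly_Mapping.update j k b \<in> A"
      by (rule A_mono) (use assms in \<open>simp_all add: update_in_exponents lookup_update\<close>)
    then show False using assms(1) by (simp add: free_def)
  qed
qed

lemma free_update [simp]: "free i (Poly_Mapping.update i k a) \<longleftrightarrow> free i a"
  by (simp add: free_def update_update)

text \<open>Truncation acts entrywise, so equal truncations stay equal when entry \<open>j\<close>
  is replaced by \<open>k\<close> in both.\<close>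

lemma free_trunc_cong:
  assumes "a \<in> exponents {1..n}" "b \<in> exponents {1..n}" "trunc n g a = trunc n g b" "j \<in> {1..n}"
  shows "free j a \<longleftrightarrow> free j b"
proof -
  have lk: "min (Poly_Mapping.lookup a i) g = min (Poly_Mapping.lookup b i) g" for i
    using assms lookup_trunc by metis
  have "Poly_Mapping.update j k a \<in> A \<longleftrightarrow> Poly_Mapping.update j k b \<in> A" for k
  proof -
    have "trunc n g (Poly_Mapping.update j k a) = trunc n g (Poly_Mapping.update j k b)"
      using assms lk by (intro poly_mapping_eqI) (simp add: lookup_trunc update_in_exponents lookup_update)
    then show ?thesis
      using trunc_iff[of "Poly_Mapping.update j k a"] trunc_iff[of "Poly_Mapping.update j k b"] assms
      by (simp add: update_in_exponents)
  qed
  then show ?thesis by (simp add: free_def)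
qed

lemma first_free_trunc_cong:
  assumes "a \<in> exponents {1..n}" "b \<in> exponents {1..n}" "trunc n g a = trunc n g b"
  shows "first_free j a \<longleftrightarrow> first_free j b"
proof (cases "j \<in> {1..n}")
  case True
  then have "free i a \<longleftrightarrow> free i b" if "i \<in> {1..<j} \<union> {j}" for i
    using free_trunc_cong[OF assms] that by auto
  then show ?thesis by (auto simp: first_free_def)
qed (auto simp: first_free_def)

lemma first_free_unique: "first_free i a \<Longrightarrow> first_free j a \<Longrightarrow> i = j"
  by (cases i j rule: linorder_cases) (auto simp: first_free_def)

lemma first_free_exists: "i \<in> {1..n} \<Longrightarrow> free i a \<Longrightarrow> \<exists>j. first_free j a"
proof -
  assume i: "i \<in> {1..n}" "free i a"
  define j where "j = (LEAST j. j \<in> {1..n} \<and> free j a)"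
  have j: "j \<in> {1..n} \<and> free j a" unfolding j_def by (rule LeastI[of _ i]) (use i in simp)
  have "\<not> free l a" if "l \<in> {1..<j}" for l
  proof
    assume "free l a"
    then have "j \<le> l" unfolding j_def using that j by (intro Least_le) (auto simp: j_def)
    then show False using that by simp
  qed
  then show ?thesis using j by (auto simp: first_free_def)
qed

text \<open>Raising entry \<open>i\<close> leaves \<open>i\<close> free and can only destroy the
  freeness of smaller variables. So the points of a line whose first free variable is its direction
  form a half line, if there are any.\<close>

lemma first_free_update_mono:
  assumes "first_free i (Poly_Mapping.update i k a)" "k \<le> l" "a \<in> exponents {1..n}"
  shows "first_free i (Poly_Mapping.update i l a)"
proof -
  have i: "i \<in> {1..n}" using assms by (simp add: first_free_def)
  have "\<not> free j (Poly_Mapping.update i l a)" if j: "j \<in> {1..<i}" for j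
  proof
    assume "free j (Poly_Mapping.update i l a)"
    then have "free j (Poly_Mapping.update i k a)"
      by (rule free_antimono) (use assms i j in \<open>auto simp: update_in_exponents lookup_update\<close>)
    then show False using assms j by (simp add: first_free_def)
  qed
  then show ?thesis using assms by (simp add: first_free_def)
qed

lemma rep_ray:
  assumes "ray i a"
  shows "rep a = (Poly_Mapping.update i (LEAST k. first_free i (Poly_Mapping.update i k a)) a, {i})"
proof -
  have "(THE i. ray i a) = i"
    using assms first_free_unique by (intro the_equality) (auto simp: ray_def)
  then show ?thesis using assms by (auto simp: rep_def Let_def)
qed

lemma rep_not_ray:
  "\<nexists>i. ray i a \<Longrightarrow> rep a = (trunc n g a, {i \<in> {1..n}. g \<le> Poly_Mapping.lookup a i})"
  by (simp add: rep_def)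

text \<open>\<open>rep\<close> is constant on each cell that it names, which makes different cells
  disjoint; the bound \<open>g\<close> on the base points makes them finite in number.\<close>

lemma rep_class:
  assumes a: "a \<in> exponents {1..n}" "a \<notin> A" and m: "rep a = (m, Z)"
  shows "Z \<subseteq> {1..n}" "m \<in> exponents {1..n}" "\<And>i. Poly_Mapping.lookup m i \<le> g" "a \<in> cell m Z"
    and "\<And>c. c \<in> cell m Z \<Longrightarrow> c \<notin> A \<and> rep c = (m, Z)"
proof -
  have "Z \<subseteq> {1..n} \<and> m \<in> exponents {1..n} \<and> (\<forall>i. Poly_Mapping.lookup m i \<le> g) \<and> a \<in> cell m Z \<and>
    (\<forall>c\<in>cell m Z. c \<notin> A \<and> rep c = (m, Z))"
  proof (cases "\<exists>i. ray i a")
    case True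
    then obtain i where i: "ray i a" by blast
    define P where "P k \<longleftrightarrow> first_free i (Poly_Mapping.update i k a)" for k
    define k0 where "k0 = (LEAST k. P k)"
    have mZ: "m = Poly_Mapping.update i k0 a" "Z = {i}"
      using m rep_ray[OF i] by (simp_all add: k0_def P_def)
    have ff: "first_free i a" and i1: "i \<in> {1..n}" using i by (auto simp: ray_def first_free_def)
    have Pa: "P (Poly_Mapping.lookup a i)" using ff by (simp add: P_def update_same)
    have k0: "P k0" unfolding k0_def by (rule LeastI[of P, OF Pa])
    have k0a: "k0 \<le> Poly_Mapping.lookup a i" unfolding k0_def by (rule Least_le[of P, OF Pa])
    \<comment> \<open>The ray starts at height at most \<open>g\<close>: above \<open>g\<close>,
      lowering the entry to \<open>g\<close> changes neither the truncation nor the first free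
      variable.\<close>
    have "P g"
    proof (cases "Poly_Mapping.lookup a i \<le> g")
      case True
      then show ?thesis using Pa first_free_update_mono[OF _ True a(1)] by (simp add: P_def)
    next
      case False
      have "trunc n g (Poly_Mapping.update i g a) = trunc n g a"
        using a i1 False by (intro poly_mapping_eqI) (auto simp: lookup_trunc update_in_exponents lookup_update)
      then show ?thesis using first_free_trunc_cong[of "Poly_Mapping.update i g a" a] ff a i1
        by (simp add: P_def update_in_exponents)
    qed
    then have k0g: "k0 \<le> g" unfolding k0_def by (rule Least_le)
    have cell: "cell m Z = {Poly_Mapping.update i k a | k. k0 \<le> k}"
    proof (intro equalityI subsetI)
      fix c assume "c \<in> cell m Z"
      then obtain w where w: "w \<in> exponents {i}" "c = m + w" by (auto simp: cell_def mZ)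
      then have "c = Poly_Mapping.update i (k0 + Poly_Mapping.lookup w i) a"
        by (intro poly_mapping_eqI) (auto simp: mZ lookup_add lookup_update in_exponents_iff)
      then show "c \<in> {Poly_Mapping.update i k a | k. k0 \<le> k}" by auto
    next
      fix c assume "c \<in> {Poly_Mapping.update i k a | k. k0 \<le> k}"
      then obtain k where "c = Poly_Mapping.update i k a" "k0 \<le> k" by blast
      then have "c = m + Poly_Mapping.single i (k - k0)"
        by (intro poly_mapping_eqI) (auto simp: mZ lookup_add lookup_update lookup_single when_def)
      then show "c \<in> cell m Z" by (auto simp: cell_def mZ)
    qed
    have "c \<notin> A \<and> rep c = (m, Z)" if "c \<in> cell m Z" for c
    proof -
      obtain k where k: "c = Poly_Mapping.update i k a" "k0 \<le> k" using \<open>c \<in> cell m Z\<close> cell by blast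
      then have ffc: "first_free i c" using k0 first_free_update_mono a by (auto simp: P_def)
      then have "ray i c" using i k by (auto simp: ray_def lookup_update)
      from rep_ray[OF this] have "rep c = (m, Z)"
        by (simp add: k update_update mZ k0_def P_def)
      moreover have "c \<notin> A" using ffc free_notin by (auto simp: first_free_def)
      ultimately show ?thesis by blast
    qed
    moreover have "a \<in> cell m Z" unfolding cell using k0a update_same[of i a, symmetric] by blast
    moreover have "Poly_Mapping.lookup m j \<le> g" for j
    proof (cases "j \<in> {1..n} - {i}")
      case True
      then show ?thesis using i unfolding ray_def by (auto simp: mZ lookup_update intro: less_imp_le)
    next
      case False
      then have "j = i \<or> Poly_Mapping.lookup a j = 0" using exponents_outside[OF a(1), of j]
        by (metis DiffI empty_iff insert_iff)
      then show ?thesis using k0g by (auto simp: mZ lookup_update)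
    qed
    moreover have "Z \<subseteq> {1..n}" "m \<in> exponents {1..n}"
      using i1 mZ update_in_exponents[OF a(1) i1] by simp_all
    ultimately show ?thesis by blast
  next
    case False
    with m have mZ: "m = trunc n g a" "Z = {i \<in> {1..n}. g \<le> Poly_Mapping.lookup a i}"
      by (simp_all add: rep_not_ray)
    have "c \<notin> A \<and> rep c = (m, Z)" if "c \<in> cell m Z" for c
    proof -
      obtain w where w: "w \<in> exponents Z" "c = m + w" using \<open>c \<in> cell m Z\<close> by (auto simp: cell_def)
      have "Z \<subseteq> {1..n}" by (auto simp: mZ(2))
      from exponents_mono[OF this] w(1) have wE: "w \<in> exponents {1..n}" by blast
      then have cE: "c \<in> exponents {1..n}" using w mZ by (simp add: exponents_add)
      have lk: "Poly_Mapping.lookup c i = min (Poly_Mapping.lookup a i) g + Poly_Mapping.lookup w i" for i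
        using w mZ a by (simp add: lookup_add lookup_trunc)
      have w0: "Poly_Mapping.lookup w i = 0" if "Poly_Mapping.lookup a i < g" for i
        using w(1) that mZ by (auto simp: in_exponents_iff)
      have tr: "trunc n g c = trunc n g a"
      proof (rule poly_mapping_eqI)
        fix i
        show "Poly_Mapping.lookup (trunc n g c) i = Poly_Mapping.lookup (trunc n g a) i"
          using w0[of i] by (cases "Poly_Mapping.lookup a i < g") (simp_all add: lookup_trunc[OF cE] lookup_trunc[OF a(1)] lk)
      qed
      have lt: "Poly_Mapping.lookup c i < g \<longleftrightarrow> Poly_Mapping.lookup a i < g" for i
        using w0[of i] by (cases "Poly_Mapping.lookup a i < g") (simp_all add: lk)
      have "c \<notin> A" using trunc_iff[OF cE] trunc_iff[OF a(1)] a(2) tr by simp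
      \<comment> \<open>The property \<open>ray\<close> depends on the truncation only, so the whole
        class stays off the rays.\<close>
      moreover have "ray i c \<longleftrightarrow> ray i a" for i
        using first_free_trunc_cong[OF cE a(1) tr] lt by (simp add: ray_def)
      then have "rep c = (trunc n g c, {i \<in> {1..n}. g \<le> Poly_Mapping.lookup c i})"
        using False by (intro rep_not_ray) simp
      then have "rep c = (m, Z)" using tr lt by (simp add: mZ not_less[symmetric])
      ultimately show ?thesis by blast
    qed
    moreover have "a \<in> cell m Z"
    proof -
      have "a = m + (a - m)"
        using a by (intro poly_mapping_eqI) (simp add: mZ lookup_add lookup_minus lookup_trunc)
      moreover have "a - m \<in> exponents Z"
        unfolding in_exponents_iff
      proof (intro allI impI)
        fix i assume "i \<notin> Z"
        then have "Poly_Mapping.lookup a i \<le> g \<or> Poly_Mapping.lookup a i = 0"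
          using a(1) by (auto simp: mZ in_exponents_iff)
        then show "Poly_Mapping.lookup (a - m) i = 0"
          using a by (auto simp: mZ lookup_minus lookup_trunc)
      qed
      ultimately show ?thesis unfolding cell_def by blast
    qed
    ultimately show ?thesis using a by (auto simp: mZ lookup_trunc)
  qed
  then show "Z \<subseteq> {1..n}" "m \<in> exponents {1..n}" "\<And>i. Poly_Mapping.lookup m i \<le> g" "a \<in> cell m Z"
    "\<And>c. c \<in> cell m Z \<Longrightarrow> c \<notin> A \<and> rep c = (m, Z)" by blast+
qed

text \<open>For the first free variable, \<open>ray\<close> fails only if another entry reaches
  \<open>g\<close>; that entry is then a direction of the truncation class.\<close>

lemma rep_nonempty:
  assumes "i \<in> {1..n}" "free i a"
  shows "snd (rep a) \<noteq> {}"
proof (cases "\<exists>i. ray i a")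
  case True
  then show ?thesis using rep_ray by auto
next
  case False
  obtain j where j: "first_free j a" using first_free_exists[OF assms] by blast
  moreover have "\<not> ray j a" using False by blast
  ultimately obtain l where "l \<in> {1..n}" "\<not> Poly_Mapping.lookup a l < g"
    unfolding ray_def by blast
  then show ?thesis by (auto simp: rep_not_ray[OF False] not_less)
qed

text \<open>Besides the lower bound, this serves upper bounds on \<open>sdepth_quot\<close>: the
  maximum has to range over a nonempty set.\<close>

lemma stanley_decomposition_exists:
  "\<exists>D. stanley_decomposition n I D \<and> set D = rep ` (exponents {1..n} - A)"
proof -
  let ?P = "rep ` (exponents {1..n} - A)"
  have "?P \<subseteq> {a \<in> exponents {1..n}. \<forall>i. Poly_Mapping.lookup a i \<le> g} \<times> Pow {1..n}"
  proof
    fix x assume "x \<in> ?P"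
    then obtain a where a: "a \<in> exponents {1..n}" "a \<notin> A" "rep a = (fst x, snd x)" by auto
    from rep_class(1-3)[OF a] show "x \<in> {a \<in> exponents {1..n}. \<forall>i. Poly_Mapping.lookup a i \<le> g} \<times> Pow {1..n}"
      by (simp add: mem_Times_iff)
  qed
  then have "finite ?P" by (rule finite_subset) (simp add: finite_bounded_exponents)
  from finite_distinct_list[OF this] obtain D where D: "set D = ?P" "distinct D" by (elim exE conjE)
  have rep: "\<exists>a. a \<in> exponents {1..n} \<and> a \<notin> A \<and> rep a = (m, Z)" if "(m, Z) \<in> set D" for m Z
    using that D by auto
  have "stanley_decomposition n I D"
  proof (rule stanley_decompositionI)
    fix m Z assume "(m, Z) \<in> set D"
    from rep[OF this] obtain a where a: "a \<in> exponents {1..n}" "a \<notin> A" "rep a = (m, Z)" by blast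
    from rep_class(1,2,5)[OF a] show "m \<in> exponents {1..n} \<and> Z \<subseteq> {1..n} \<and> cell m Z \<inter> A = {}" by blast
  next
    fix i j assume ij: "i < length D" "j < length D" "i \<noteq> j"
    have mem: "(fst (D ! i), snd (D ! i)) \<in> set D" "(fst (D ! j), snd (D ! j)) \<in> set D"
      using ij by auto
    from rep[OF mem(1)] obtain a
      where a: "a \<in> exponents {1..n}" "a \<notin> A" "rep a = (fst (D ! i), snd (D ! i))" by blast
    from rep[OF mem(2)] obtain b
      where b: "b \<in> exponents {1..n}" "b \<notin> A" "rep b = (fst (D ! j), snd (D ! j))" by blast
    show "cell (fst (D ! i)) (snd (D ! i)) \<inter> cell (fst (D ! j)) (snd (D ! j)) = {}"
    proof (rule ccontr)
      assume "\<not> ?thesis"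
      then obtain c where "c \<in> cell (fst (D ! i)) (snd (D ! i))" "c \<in> cell (fst (D ! j)) (snd (D ! j))" by blast
      with rep_class(5)[OF a] rep_class(5)[OF b] have "D ! i = D ! j" by (metis prod.collapse)
      with D ij show False by (simp add: nth_eq_iff_index_eq)
    qed
  next
    show "exponents {1..n} - A \<subseteq> (\<Union>(m, Z)\<in>set D. cell m Z)"
    proof
      fix a assume a: "a \<in> exponents {1..n} - A"
      obtain m Z where mZ: "rep a = (m, Z)" by (cases "rep a")
      then have "(m, Z) \<in> set D" using a D by (metis imageI)
      moreover have "a \<in> cell m Z" using rep_class(4)[OF _ _ mZ] a by simp
      ultimately show "a \<in> (\<Union>(m, Z)\<in>set D. cell m Z)" by blast
    qed
  qed
  with D show ?thesis by blast
qed

section \<open>Bounds for the Stanley depth\<close>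

lemma sdepth_decomposition_le_card:
  assumes "(m, Z) \<in> set D" "Z \<subseteq> V" "finite V"
  shows "sdepth_decomposition D \<le> card V"
proof -
  have "sdepth_decomposition D \<le> card Z"
    unfolding sdepth_decomposition_def using assms(1) by (intro Min_le) force+
  also have "card Z \<le> card V" using assms by (intro card_mono)
  finally show ?thesis .
qed

text \<open>The piece that contains \<open>u\<close> also contains its products with the variables
  of that piece, so these variables lie in \<open>V\<close>. For empty \<open>V\<close> the monomial
  \<open>u\<close> is in the socle.\<close>

lemma sdepth_le:
  assumes u: "u \<in> exponents {1..n} - A" and V: "V \<subseteq> {1..n}"
    and out: "\<And>i. i \<in> {1..n} - V \<Longrightarrow> u + Poly_Mapping.single i 1 \<in> A"
  shows "sdepth_quot n I \<le> card V"
proof -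
  let ?X = "{sdepth_decomposition D | D. stanley_decomposition n I D}"
  have le: "x \<le> card V" if x: "x \<in> ?X" for x
  proof -
    obtain D where D: "x = sdepth_decomposition D" "stanley_decomposition n I D" using x by blast
    from stanley_decomposition_covers[OF D(2) u] obtain m Z where mZ: "(m, Z) \<in> set D" "u \<in> cell m Z"
      "Z \<subseteq> {1..n}" "cell m Z \<inter> A = {}" by blast
    have "Z \<subseteq> V"
    proof
      fix i assume i: "i \<in> Z"
      have "u + Poly_Mapping.single i 1 \<in> cell m Z"
      proof -
        obtain w where w: "u = m + w" "w \<in> exponents Z" using mZ(2) by (auto simp: cell_def)
        then have "u + Poly_Mapping.single i 1 = m + (w + Poly_Mapping.single i 1)" by (simp add: add.assoc)
        moreover have "w + Poly_Mapping.single i 1 \<in> exponents Z" using w i by (simp add: exponents_add)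
        ultimately show ?thesis unfolding cell_def by blast
      qed
      then have "u + Poly_Mapping.single i 1 \<notin> A" using mZ(4) by blast
      then show "i \<in> V" using out i mZ(3) by blast
    qed
    moreover have "finite V" using V finite_subset by blast
    ultimately show ?thesis unfolding D(1) by (rule sdepth_decomposition_le_card[OF mZ(1)])
  qed
  then have "finite ?X" by (intro finite_subset[of ?X "{..card V}"]) auto
  moreover have "?X \<noteq> {}" using stanley_decomposition_exists by blast
  ultimately show ?thesis unfolding sdepth_quot_def using le by (intro Max.boundedI) auto
qed

text \<open>By \<open>sat\<close> every exponent outside of \<open>A\<close> has a free variable, so
  the decomposition given by \<open>rep\<close> has no zero-dimensional piece.\<close>

lemma sdepth_positive:
  assumes sat: "\<And>a. a \<in> exponents {1..n} - A \<Longrightarrow> \<exists>i\<in>{1..n}. \<forall>k. Poly_Mapping.update i k a \<notin> A"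
  shows "0 < sdepth_quot n I"
proof -
  let ?X = "{sdepth_decomposition D | D. stanley_decomposition n I D}"
  obtain D where D: "stanley_decomposition n I D" "set D = rep ` (exponents {1..n} - A)"
    using stanley_decomposition_exists by blast
  have zero: "0 \<in> exponents {1..n} - A" using proper by simp
  then have "rep 0 \<in> set D" unfolding D(2) by (rule imageI)
  then have "set D \<noteq> {}" by auto
  moreover have "0 < card Z" if mem: "(m, Z) \<in> set D" for m Z
  proof -
    from mem D obtain a where a: "a \<in> exponents {1..n}" "a \<notin> A" "rep a = (m, Z)" by auto
    then obtain i where "i \<in> {1..n}" "free i a" using sat[of a] by (auto simp: free_def)
    from rep_nonempty[OF this] a have "Z \<noteq> {}" by simp
    moreover have "finite Z" using rep_class(1)[OF a] finite_subset by blast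
    ultimately show ?thesis by (simp add: card_gt_0_iff)
  qed
  ultimately have pos: "0 < sdepth_decomposition D"
    unfolding sdepth_decomposition_def by (subst Min_gr_iff) auto
  \<comment> \<open>The piece that contains the monomial 1 bounds each value by \<open>n\<close>, so
    the maximum is over a finite set.\<close>
  have bound: "x \<le> n" if x: "x \<in> ?X" for x
  proof -
    obtain D where D: "x = sdepth_decomposition D" "stanley_decomposition n I D" using x by blast
    from stanley_decomposition_covers[OF D(2) zero] obtain m Z where
      "(m, Z) \<in> set D" "Z \<subseteq> {1..n}" by blast
    from sdepth_decomposition_le_card[OF this] D(1) show ?thesis by simp
  qed
  then have "finite ?X" by (intro finite_subset[of ?X "{..n}"]) auto
  then have "sdepth_decomposition D \<le> sdepth_quot n I"
    unfolding sdepth_quot_def using D by (intro Max_ge) auto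
  with pos show ?thesis by simp
qed

end

section \<open>Powers of path ideals\<close>

definition edge :: "nat \<Rightarrow> nat \<Rightarrow> nat set" where
  "edge n e = {e, nxt n e}"

lemma shift_mod_image:
  fixes c n :: nat
  assumes "c \<le> n"
  shows "(\<lambda>k. (k + c) mod n) ` {..<n} = {..<n}"
proof (intro equalityI subsetI)
  fix e assume e: "e \<in> {..<n}"
  have "((e + (n - c)) mod n + c) mod n = (e + (n - c) + c) mod n" by (rule mod_add_left_eq)
  also have "\<dots> = e" using e assms by simp
  finally show "e \<in> (\<lambda>k. (k + c) mod n) ` {..<n}"
    using e by (intro image_eqI[of _ _ "(e + (n - c)) mod n"]) auto
qed auto

text \<open>A rotation only permutes the generators, so that each can be named by the vertex or the
  edge that it misses instead of its starting point.\<close>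

lemma omit_reindex:
  assumes "c \<le> n" and "\<And>k. k < n \<Longrightarrow> N k = N' ((k + c) mod n)"
  shows "omit n N = omit n N'"
proof -
  have "omit n N = (\<lambda>e. expo n (\<lambda>v. if v \<in> N' e then 0 else 1)) ` (\<lambda>k. (k + c) mod n) ` {..<n}"
    unfolding omit_def image_image using assms(2) by (intro image_cong) auto
  then show ?thesis by (simp only: shift_mod_image[OF assms(1)] omit_def)
qed

lemma omit_gap_one:
  assumes "1 \<le> n"
  shows "omit n (gap n (n - 1)) = omit n (\<lambda>e. {e})"
proof (rule omit_reindex[of "n - 1"])
  have "{n - 1..<n} = {n - 1}" using assms by auto
  then show "gap n (n - 1) k = {(k + (n - 1)) mod n}" for k by (simp add: gap_def)
qed simp

lemma omit_gap_two:
  assumes "2 \<le> n"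
  shows "omit n (gap n (n - 2)) = omit n (edge n)"
proof (rule omit_reindex[of "n - 2"])
  fix k
  have "{n - 2..<n} = {n - 2, n - 1}" using assms by auto
  moreover have "nxt n ((k + (n - 2)) mod n) = (k + (n - 1)) mod n"
  proof -
    have "nxt n ((k + (n - 2)) mod n) = Suc (k + (n - 2)) mod n" by (rule mod_Suc_eq)
    also have "Suc (k + (n - 2)) = k + (n - 1)" using assms by simp
    finally show ?thesis .
  qed
  ultimately show "gap n (n - 2) k = edge n ((k + (n - 2)) mod n)"
    by (simp add: gap_def edge_def insert_commute)
qed simp

text \<open>The power is proper by the degree bound at exponent 0, as \<open>c < n\<close> leaves a
  variable in every generator.\<close>

lemma bounded_monomial_ideal_omit:
  assumes t: "1 \<le> t" and c: "\<And>e. e < n \<Longrightarrow> card ({..<n} \<inter> N e) \<le> c" "c < n"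
  shows "bounded_monomial_ideal n (exponent_power n (omit n N) t)
    (monomial_span (exponent_power n (omit n N) t) :: 'k::field mpoly set) t"
proof
  let ?A = "exponent_power n (omit n N) t"
  show "?A \<subseteq> exponents {1..n}" by (rule exponent_power_subset[OF omit_subset])
  show "a + b \<in> ?A" if "a \<in> ?A" "b \<in> exponents {1..n}" for a b
    using that by (rule exponent_power_add)
  show "trunc n t a \<in> ?A \<longleftrightarrow> a \<in> ?A" if "a \<in> exponents {1..n}" for a
    using that by (rule exponent_power_omit_trunc)
  show "0 \<notin> ?A"
  proof
    assume "0 \<in> ?A"
    then have "expo n (\<lambda>_. 0) \<in> ?A" by (simp add: expo_def)
    from exponent_power_omit_sum_ge[OF this subset_refl c(1)] have "t * n \<le> t * c" by simp
    then show False using t c(2) by simp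
  qed
qed simp

text \<open>Multiplication by the \<open>r\<close>-th power of generator \<open>e\<close>. It
  carries memberships in the smallest relevant power over to larger powers.\<close>

lemma exponent_power_shift:
  assumes "e < n" "expo n h \<in> exponent_power n (omit n N) s"
  shows "expo n (\<lambda>v. h v + (if v \<in> N e then 0 else r)) \<in> exponent_power n (omit n N) (s + r)"
proof (induction r)
  case 0
  then show ?case using assms by simp
next
  case (Suc r)
  have "expo n (\<lambda>v. h v + (if v \<in> N e then 0 else Suc r))
      = expo n (\<lambda>v. h v + (if v \<in> N e then 0 else r)) + expo n (\<lambda>v. if v \<in> N e then 0 else 1)"
    by (simp add: expo_add expo_eq_iff)
  moreover have "expo n (\<lambda>v. if v \<in> N e then 0 else 1) \<in> omit n N"
    using assms by (auto simp: omit_def)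
  ultimately show ?case using Suc by auto
qed

lemma sum_const_off:
  fixes r :: nat
  assumes "finite V"
  shows "(\<Sum>v\<in>V. c + (if v \<in> X then 0 else r)) = card V * c + card (V - X) * r"
proof -
  have "(\<Sum>v\<in>V. if v \<in> X then 0 else r) = (\<Sum>v\<in>V - X. r)"
    using assms by (intro sum.mono_neutral_cong_right) auto
  then show ?thesis by (simp add: sum.distrib)
qed

lemma expo_add_single:
  "w < n \<Longrightarrow> expo n f + Poly_Mapping.single (Suc w) k = expo n (\<lambda>v. f v + (if v = w then k else 0))"
  by (simp add: single_eq_expo expo_add)

lemma vertex_of_variable: "i \<in> {1..n} \<Longrightarrow> \<exists>w<n. i = Suc w"
  by (cases i) auto

lemma exponent_power_vertex_iff:
  "expo n f \<in> exponent_power n (omit n (\<lambda>e. {e})) t \<longleftrightarrow>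
    (\<exists>y. sum y {..<n} = t \<and> (\<forall>v<n. t \<le> f v + y v))"
proof -
  have "hits n (\<lambda>e. {e}) v = {v}" if "v < n" for v using that by (auto simp: hits_def)
  then show ?thesis unfolding exponent_power_omit_iff by (intro ex_cong1 conj_cong refl all_cong) auto
qed

text \<open>The generators that miss a vertex belong to the two edges at it, so membership is an
  edge cover; truncated subtraction gives demand 0 where \<open>f v\<close> is at least
  \<open>t\<close>.\<close>

lemma exponent_power_edge_iff:
  assumes "2 \<le> n"
  shows "expo n f \<in> exponent_power n (omit n (edge n)) t \<longleftrightarrow>
    (\<exists>y. sum y {..<n} = t \<and> covers n y (\<lambda>v. t - f v))"
proof -
  have hits: "sum y (hits n (edge n) (nxt n e)) = y e + y (nxt n e)" if e: "e < n" for e and y :: "nat \<Rightarrow> nat"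
  proof -
    have "e' \<in> hits n (edge n) (nxt n e) \<longleftrightarrow> e' = e \<or> e' = nxt n e" for e'
      unfolding hits_def edge_def mem_Collect_eq insert_iff empty_iff
      using e nxt_less[OF e] nxt_inj[OF e, of e'] by metis
    then have "hits n (edge n) (nxt n e) = {e, nxt n e}" by blast
    then show ?thesis using nxt_neq[OF assms e] by simp
  qed
  have "(\<forall>v<n. t \<le> f v + sum y (hits n (edge n) v)) \<longleftrightarrow> covers n y (\<lambda>v. t - f v)" (is "?L \<longleftrightarrow> ?R") for y
  proof
    assume L: ?L
    show ?R
      unfolding covers_def
    proof (intro allI impI)
      fix e assume e: "e < n"
      have "t \<le> f (nxt n e) + sum y (hits n (edge n) (nxt n e))" using L nxt_less[OF e] by blast
      then show "t - f (nxt n e) \<le> y e + y (nxt n e)" by (simp add: hits[OF e])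
    qed
  next
    assume R: ?R
    show ?L
    proof (intro allI impI)
      fix v assume "v < n"
      then obtain e where e: "e < n" "nxt n e = v" using nxt_surj by blast
      then have "t - f v \<le> y e + y v" using R unfolding covers_def by blast
      then show "t \<le> f v + sum y (hits n (edge n) v)" using hits[OF e(1), of y] e by simp
    qed
  qed
  then show ?thesis unfolding exponent_power_omit_iff by simp
qed

text \<open>The witness is the product of all variables to the power \<open>n - 2\<close> times the
  \<open>r\<close>-th power of generator \<open>0\<close>; it fails the degree bound by one. After
  multiplication by a variable, the \<open>n - 1\<close> generators that miss the other vertices
  show membership.\<close>

lemma vertex_power_socle:
  assumes n: "2 \<le> n" and t: "n - 1 \<le> t"
  shows "\<exists>u\<in>exponents {1..n} - exponent_power n (omit n (\<lambda>e. {e})) t.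
    \<forall>i\<in>{1..n}. u + Poly_Mapping.single i 1 \<in> exponent_power n (omit n (\<lambda>e. {e})) t"
proof -
  let ?A = "exponent_power n (omit n (\<lambda>e. {e})) t"
  obtain r where r: "t = n - 1 + r" using t le_Suc_ex by blast
  define f where "f v = n - 2 + (if v \<in> {0::nat} then 0 else r)" for v
  have "expo n f \<notin> ?A"
  proof
    assume A: "expo n f \<in> ?A"
    have "card ({..<n} \<inter> {e}) \<le> 1" for e :: nat by (rule order_trans[OF card_mono[of "{e}"]]) auto
    from exponent_power_omit_sum_ge[OF A subset_refl this] have "t * n \<le> sum f {..<n} + t" by simp
    also have "sum f {..<n} = n * (n - 2) + (n - 1) * r"
      unfolding f_def by (subst sum_const_off) (use n in simp_all)
    finally show False using n unfolding r by (cases n) (auto simp: algebra_simps numeral_2_eq_2 dest!: Suc_le_D)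
  qed
  moreover have "expo n f + Poly_Mapping.single i 1 \<in> ?A" if i: "i \<in> {1..n}" for i
  proof -
    obtain w where w: "w < n" "i = Suc w" using vertex_of_variable[OF i] by blast
    have "sum (\<lambda>e. if e = w then 0 else 1) {..<n} = n - 1"
    proof -
      have "sum (\<lambda>e. if e = w then 0 else 1) {..<n} = sum (\<lambda>_. 1::nat) ({..<n} - {w})"
        by (intro sum.mono_neutral_cong_right) auto
      then show ?thesis using w by simp
    qed
    then have "expo n (\<lambda>v. n - 2 + (if v = w then 1 else 0)) \<in> exponent_power n (omit n (\<lambda>e. {e})) (n - 1)"
      unfolding exponent_power_vertex_iff using n by (intro exI[of _ "\<lambda>e. if e = w then 0 else 1"]) auto
    from exponent_power_shift[OF _ this, of 0 r] n show ?thesis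
      by (simp add: w expo_add_single f_def r add.assoc add.commute[of "if _ then _ else r"])
  qed
  ultimately show ?thesis by (intro bexI[of _ "expo n f"]) auto
qed

lemma card_Int_edge_le: "card (V \<inter> edge n e) \<le> 2"
proof -
  have "card (V \<inter> edge n e) \<le> card {e, nxt n e}" by (intro card_mono) (auto simp: edge_def)
  also have "\<dots> \<le> 2" by (simp add: card_insert_if)
  finally show ?thesis .
qed

text \<open>The witness is the product of all variables to the power \<open>s - 1\<close> times the
  \<open>r\<close>-th power of generator \<open>0\<close>, and again fails the degree bound by one.
  Its product with a variable is handled by the matching that leaves out that vertex.\<close>

lemma edge_power_socle:
  assumes n: "n = 2 * s + 1" "3 \<le> n" and t: "s \<le> t"
  shows "\<exists>u\<in>exponents {1..n} - exponent_power n (omit n (edge n)) t.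
    \<forall>i\<in>{1..n}. u + Poly_Mapping.single i 1 \<in> exponent_power n (omit n (edge n)) t"
proof -
  let ?A = "exponent_power n (omit n (edge n)) t"
  obtain r where r: "t = s + r" using t le_Suc_ex by blast
  define f where "f v = s - 1 + (if v \<in> edge n 0 then 0 else r)" for v
  have "expo n f \<notin> ?A"
  proof
    assume A: "expo n f \<in> ?A"
    from exponent_power_omit_sum_ge[OF A subset_refl card_Int_edge_le]
    have "t * n \<le> sum f {..<n} + t * 2" by simp
    also have "sum f {..<n} = n * (s - 1) + (n - 2) * r"
    proof -
      have "card ({..<n} - edge n 0) = n - 2"
        using n by (subst card_Diff_subset) (auto simp: edge_def)
      then show ?thesis unfolding f_def by (subst sum_const_off) simp_all
    qed
    finally show False using n unfolding r by (cases s) (auto simp: algebra_simps)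
  qed
  moreover have "expo n f + Poly_Mapping.single i 1 \<in> ?A" if i: "i \<in> {1..n}" for i
  proof -
    obtain w where w: "w < n" "i = Suc w" using vertex_of_variable[OF i] by blast
    obtain y where y: "sum y {..<n} = s" "covers n y (\<lambda>v. if v = w then 0 else 1)"
      using near_perfect_matching[OF n w(1)] by blast
    have "s - (s - 1 + (if v = w then 1 else 0)) = (if v = w then 0 else 1)" for v
      using n by auto
    then have "expo n (\<lambda>v. s - 1 + (if v = w then 1 else 0)) \<in> exponent_power n (omit n (edge n)) s"
      using y n by (subst exponent_power_edge_iff) auto
    from exponent_power_shift[OF _ this, of 0 r] n
    have "expo n (\<lambda>v. s - 1 + (if v = w then 1 else 0) + (if v \<in> edge n 0 then 0 else r)) \<in> ?A"
      by (simp add: r)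
    moreover have "expo n f + Poly_Mapping.single i 1
        = expo n (\<lambda>v. s - 1 + (if v = w then 1 else 0) + (if v \<in> edge n 0 then 0 else r))"
      unfolding w(2) expo_add_single[OF w(1)] by (simp add: f_def expo_eq_iff)
    ultimately show ?thesis by simp
  qed
  ultimately show ?thesis by (intro bexI[of _ "expo n f"]) auto
qed

text \<open>Changing the entry at a vertex affects only the demand there. If every vertex had a
  change that leads into the power, each vertex could be dropped from the demands, and all demands
  could be met.\<close>

lemma edge_power_saturated:
  assumes n: "3 \<le> n" "even n \<or> 2 * t < n - 1"
    and a: "a \<in> exponents {1..n} - exponent_power n (omit n (edge n)) t"
  shows "\<exists>i\<in>{1..n}. \<forall>k. Poly_Mapping.update i k a \<notin> exponent_power n (omit n (edge n)) t"
proof (rule ccontr)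
  assume neg: "\<not> ?thesis"
  define f where "f v = Poly_Mapping.lookup a (Suc v)" for v
  have af: "a = expo n f" unfolding f_def using a by (simp add: expo_of_lookup)
  have "\<exists>y. sum y {..<n} = t \<and> covers n y (\<lambda>v. t - f v)"
  proof (rule edge_cover_saturated[OF n])
    fix i assume i: "i < n"
    then have "Suc i \<in> {1..n}" by simp
    with neg obtain k where k: "Poly_Mapping.update (Suc i) k a \<in> exponent_power n (omit n (edge n)) t" by blast
    have "Poly_Mapping.update (Suc i) k a = expo n (f(i := k))"
      unfolding af using i by (intro poly_mapping_eqI) (auto simp: lookup_update lookup_expo)
    with k n obtain y where "sum y {..<n} = t" "covers n y (\<lambda>v. t - (f(i := k)) v)"
      by (auto simp: exponent_power_edge_iff)
    then show "\<exists>y. sum y {..<n} = t \<and> (\<forall>e<n. nxt n e \<noteq> i \<longrightarrow> t - f (nxt n e) \<le> y e + y (nxt n e))"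
      by (intro exI[of _ y]) (auto simp: covers_def)
  qed
  then have "a \<in> exponent_power n (omit n (edge n)) t" using n by (simp add: af exponent_power_edge_iff)
  then show False using a by simp
qed

section \<open>The corner monomial of an even cycle\<close>

locale even_cycle =
  fixes n s t r :: nat
  assumes n: "n = 2 * s" and s: "2 \<le> s" and t: "t = s - 1 + r"
begin

text \<open>The exponent of the monomial with annihilator generated by the products of an odd and an
  even variable: the product of all variables to the power \<open>s - 2\<close> times
  \<open>r\<close> copies of the generator that misses edge \<open>0\<close>.\<close>

definition corner :: "nat \<Rightarrow> nat" where
  "corner v = s - 2 + (if v \<in> edge n 0 then 0 else r)"

text \<open>An edge meets a parity class at most once, and the degree bound on \<open>V\<close>
  alone fails by one. Values of \<open>f\<close> outside of \<open>V\<close> are arbitrary, so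
  variables of the other class never carry the corner into the power.\<close>

lemma parity_class_notin:
  assumes V: "V = {v. v < n \<and> even v} \<or> V = {v. v < n \<and> odd v}"
    and f: "\<And>v. v \<in> V \<Longrightarrow> f v = corner v"
  shows "expo n f \<notin> exponent_power n (omit n (edge n)) t"
proof
  assume A: "expo n f \<in> exponent_power n (omit n (edge n)) t"
  have sub: "V \<subseteq> {..<n}" using V by auto
  have cardV: "card V = s" using V card_even_below[of s] card_odd_below[of s] by (auto simp: n)
  have "card (V \<inter> edge n e) \<le> 1" if e: "e < n" for e
  proof -
    have "even (nxt n e) \<longleftrightarrow> even (Suc e)" by (rule dvd_mod_iff) (simp add: n)
    then have "even (nxt n e) \<longleftrightarrow> odd e" by simp
    then have "V \<inter> edge n e \<subseteq> {e} \<or> V \<inter> edge n e \<subseteq> {nxt n e}" using V by (auto simp: edge_def)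
    then show ?thesis using card_mono[of "{e}" "V \<inter> edge n e"] card_mono[of "{nxt n e}" "V \<inter> edge n e"] by auto
  qed
  from exponent_power_omit_sum_ge[OF A sub this] have "t * s \<le> sum f V + t" by (simp add: cardV)
  also have "sum f V = s * (s - 2) + card (V - edge n 0) * r"
  proof -
    have "sum f V = sum corner V" using f by (intro sum.cong) auto
    also have "\<dots> = card V * (s - 2) + card (V - edge n 0) * r"
      unfolding corner_def using sub by (intro sum_const_off) (auto intro: finite_subset)
    finally show ?thesis by (simp add: cardV)
  qed
  also have "card (V - edge n 0) = s - 1"
  proof -
    have "nxt n 0 = 1" using n s by simp
    then have "edge n 0 = {0, 1}" by (simp add: edge_def)
    then have "V - edge n 0 = V - {if 0 \<in> V then 0 else 1}" "(if 0 \<in> V then 0 else 1) \<in> V"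
      using V n s by auto
    then show ?thesis using cardV by simp
  qed
  finally have "(s - 1 + r) * s \<le> s * (s - 2) + (s - 1) * r + (s - 1 + r)" by (simp add: t)
  moreover obtain q where "s = q + 2" using s le_Suc_ex by (metis add.commute)
  ultimately show False by (simp add: algebra_simps)
qed

text \<open>The matching that leaves out \<open>i\<close> and \<open>j\<close> supplies
  \<open>s - 1\<close> generators, the \<open>r\<close> copies of generator \<open>0\<close> the
  rest.\<close>

lemma corner_mixed:
  assumes "i < n" "j < n" "odd i" "even j"
  shows "expo n (\<lambda>v. corner v + (if v = i \<or> v = j then 1 else 0)) \<in> exponent_power n (omit n (edge n)) t"
proof -
  have n3: "3 \<le> n" using n s by simp
  obtain y where y: "sum y {..<n} = s - 1" "covers n y (\<lambda>v. if v = i \<or> v = j then 0 else 1)"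
    using bipartite_matching_off[OF n n3 assms] by blast
  have "s - 1 - (s - 2 + (if v = i \<or> v = j then 1 else 0)) = (if v = i \<or> v = j then 0 else 1)" for v
    using s by auto
  then have "expo n (\<lambda>v. s - 2 + (if v = i \<or> v = j then 1 else 0)) \<in> exponent_power n (omit n (edge n)) (s - 1)"
    using y n3 by (subst exponent_power_edge_iff) auto
  from exponent_power_shift[OF _ this, of 0 r] n3 show ?thesis
    by (simp add: corner_def t add.assoc add.commute[of "if _ then _ else r"])
qed

end

theorem theorem2p2:
  fixes n :: nat and J :: "nat \<Rightarrow> nat \<Rightarrow> 'k::field mpoly set"
  assumes "n \<ge> 2"
    and J: "\<And>m t. J m t = cycle_path_ideal_power n m t"
  shows "(\<forall>t \<ge> n - 1. sdepth_quot n (J (n - 1) t) = 0 \<and> depth_quot n (J (n - 1) t) = 0)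
    \<and> (n \<ge> 3 \<and> odd n \<longrightarrow>
        (\<forall>t \<ge> (n - 1) div 2.
          sdepth_quot n (J (n - 2) t) = 0 \<and> depth_quot n (J (n - 2) t) = 0))
    \<and> (n \<ge> 5 \<and> odd n \<longrightarrow>
        (\<forall>t. 1 \<le> t \<and> t < (n - 1) div 2 \<longrightarrow>
          sdepth_quot n (J (n - 2) t) > 0 \<and> depth_quot n (J (n - 2) t) > 0))
    \<and> (n \<ge> 5 \<and> even n \<longrightarrow>
        (\<forall>t \<ge> 1. sdepth_quot n (J (n - 2) t) > 0 \<and> depth_quot n (J (n - 2) t) > 0))
    \<and> (n \<ge> 5 \<and> even n \<longrightarrow>
        (\<forall>t \<ge> n - 1.
          n div 2 \<ge> sdepth_quot n (J (n - 2) t) \<and>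
          enat (sdepth_quot n (J (n - 2) t)) \<ge> depth_quot n (J (n - 2) t) \<and>
          depth_quot n (J (n - 2) t) = 1))"
proof -
  let ?A1 = "exponent_power n (omit n (\<lambda>e. {e}))" and ?A2 = "exponent_power n (omit n (edge n))"
  have J1: "J (n - 1) t = monomial_span (?A1 t)" for t
    using assms(1) by (simp add: J cycle_path_ideal_power_eq omit_gap_one)
  have J2: "J (n - 2) t = monomial_span (?A2 t)" for t
    using assms(1) by (simp add: J cycle_path_ideal_power_eq omit_gap_two)
  have loc1: "bounded_monomial_ideal n (?A1 t) (J (n - 1) t) t" if "1 \<le> t" for t
    unfolding J1 by (rule bounded_monomial_ideal_omit[OF that, of _ _ 1]) (use assms(1) in auto)
  have loc2: "bounded_monomial_ideal n (?A2 t) (J (n - 2) t) t" if "1 \<le> t" "3 \<le> n" for t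
    unfolding J2 using that(2) by (intro bounded_monomial_ideal_omit[OF that(1) card_Int_edge_le]) simp
  \<comment> \<open>One socle monomial settles both invariants.\<close>
  have zero: "sdepth_quot n I = 0 \<and> depth_quot n I = 0"
    if loc: "bounded_monomial_ideal n A I t" and u: "u \<in> exponents {1..n} - A"
      "\<forall>i\<in>{1..n}. u + Poly_Mapping.single i 1 \<in> A" for A t u and I :: "'k mpoly set"
  proof -
    interpret bounded_monomial_ideal n A I t by (rule loc)
    show ?thesis using depth_eq_zero[OF u(1)] sdepth_le[OF u(1), of "{}"] u(2) by simp
  qed
  have pos: "sdepth_quot n (J (n - 2) t) > 0 \<and> 1 \<le> depth_quot n (J (n - 2) t)"
    if t: "1 \<le> t" and n: "3 \<le> n" "even n \<or> 2 * t < n - 1" for t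
  proof -
    interpret bounded_monomial_ideal n "?A2 t" "J (n - 2) t" t by (rule loc2[OF t n(1)])
    note sat = edge_power_saturated[OF n]
    show ?thesis using sdepth_positive[OF sat] depth_ge_one[OF sat proper] by simp
  qed
  have top: "sdepth_quot n (J (n - 2) t) \<le> n div 2 \<and> depth_quot n (J (n - 2) t) \<le> 1"
    if n5: "5 \<le> n" "even n" and t: "n - 1 \<le> t" for t
  proof -
    interpret bounded_monomial_ideal n "?A2 t" "J (n - 2) t" t using n5 t by (intro loc2) auto
    define s where "s = n div 2"
    define r where "r = t - (s - 1)"
    interpret C: even_cycle n s t r
      by standard (use n5 t in \<open>auto simp: s_def r_def elim!: evenE\<close>)
    \<comment> \<open>Variables are vertices shifted by one, so \<open>P\<close> consists of the
      even indices and \<open>Q\<close> of the odd ones.\<close>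
    define P Q where "P = Suc ` {v. v < n \<and> odd v}" and "Q = Suc ` {v. v < n \<and> even v}"
    have PQ: "P \<union> Q = {1..n}"
      using vertex_of_variable[of _ n] by (fastforce simp: P_def Q_def)
    have "depth_quot n (J (n - 2) t) \<le> 1"
    proof (rule depth_le_one[OF _ PQ])
      show "expo n C.corner \<in> exponents {1..n}" by simp
      fix i j assume "i \<in> P" "j \<in> Q"
      then obtain v w where vw: "i = Suc v" "v < n" "odd v" "j = Suc w" "w < n" "even w"
        by (auto simp: P_def Q_def)
      then have "v \<noteq> w" by auto
      then have "expo n C.corner + Poly_Mapping.single i 1 + Poly_Mapping.single j 1
          = expo n (\<lambda>u. C.corner u + (if u = v \<or> u = w then 1 else 0))"
        using vw by (simp add: expo_add_single expo_eq_iff)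
      with C.corner_mixed[of v w] vw
      show "expo n C.corner + Poly_Mapping.single i 1 + Poly_Mapping.single j 1 \<in> ?A2 t" by simp
    next
      \<comment> \<open>\<open>x_2\<close> belongs to the odd vertex 1, so the even class still
        keeps the monomial outside of the power; for \<open>x_1\<close> the odd class does.\<close>
      show "2 \<in> P - Q" using n5 by (auto simp: P_def Q_def image_iff intro: exI[of _ 1])
      have "expo n C.corner + Poly_Mapping.single (Suc 1) 1 = expo n (\<lambda>v. C.corner v + (if v = 1 then 1 else 0))"
        using n5 by (intro expo_add_single) simp
      moreover have "\<dots> \<notin> ?A2 t" by (rule C.parity_class_notin[OF disjI1[OF refl]]) auto
      ultimately show "expo n C.corner + Poly_Mapping.single 2 1 \<notin> ?A2 t" by (simp add: numeral_2_eq_2 One_nat_def)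
      show "1 \<in> Q" using n5 by (auto simp: Q_def image_iff One_nat_def)
      have "expo n C.corner + Poly_Mapping.single (Suc 0) 1 = expo n (\<lambda>v. C.corner v + (if v = 0 then 1 else 0))"
        using n5 by (intro expo_add_single) simp
      moreover have "\<dots> \<notin> ?A2 t" by (rule C.parity_class_notin[OF disjI2[OF refl]]) (auto intro: odd_pos)
      ultimately show "expo n C.corner + Poly_Mapping.single 1 1 \<notin> ?A2 t" by (simp add: One_nat_def)
    qed
    moreover have "sdepth_quot n (J (n - 2) t) \<le> card Q"
    proof (rule sdepth_le)
      \<comment> \<open>Raising the exponents at even vertices to \<open>t\<close> stays outside of
        the power, but makes every variable in \<open>P\<close> lead into it. Only variables in
        \<open>Q\<close> remain for the piece at this monomial.\<close>
      define f where "f v = (if even v then t else C.corner v)" for v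
      show "expo n f \<in> exponents {1..n} - ?A2 t"
        using C.parity_class_notin[OF disjI2[OF refl], of f] by (simp add: f_def)
      show "Q \<subseteq> {1..n}" using PQ by blast
      fix i assume "i \<in> {1..n} - Q"
      then have "i \<in> P" using PQ by blast
      then obtain w where w: "i = Suc w" "w < n" "odd w" by (auto simp: P_def)
      \<comment> \<open>Vertex \<open>0\<close> serves as the even partner of \<open>w\<close>: this
        mixed multiple of the corner divides the product of the raised monomial with
        \<open>x_i\<close>.\<close>
      have "expo n (\<lambda>v. C.corner v + (if v = w \<or> v = 0 then 1 else 0)) \<in> ?A2 t"
        using w n5 by (intro C.corner_mixed) auto
      moreover have "expo n f + Poly_Mapping.single i 1 \<in> exponents {1..n}"
        using w by (simp add: expo_add_single)
      moreover have "C.corner v + 1 \<le> t" for v using C.s C.t by (auto simp: C.corner_def)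
      then have "Poly_Mapping.lookup (expo n (\<lambda>v. C.corner v + (if v = w \<or> v = 0 then 1 else 0))) x
          \<le> Poly_Mapping.lookup (expo n f + Poly_Mapping.single i 1) x" for x
        using w by (auto simp: expo_add_single lookup_expo f_def intro: order_trans[OF le_add1])
      ultimately show "expo n f + Poly_Mapping.single i 1 \<in> ?A2 t" by (rule A_mono)
    qed
    moreover have "card Q = n div 2"
    proof -
      have "card Q = card {v. v < n \<and> even v}" by (simp add: Q_def card_image)
      also have "\<dots> = s" using card_even_below[of s] by (simp add: C.n)
      finally show ?thesis by (simp add: s_def)
    qed
    ultimately show ?thesis by simp
  qed
  show ?thesis
  proof (intro conjI impI allI)
    fix t :: nat assume t: "n - 1 \<le> t"
    have "1 \<le> t" using t assms(1) by simp
    from vertex_power_socle[OF assms(1) t] obtain u where u: "u \<in> exponents {1..n} - ?A1 t"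
      "\<forall>i\<in>{1..n}. u + Poly_Mapping.single i 1 \<in> ?A1 t" by (rule bexE)
    from zero[OF loc1[OF \<open>1 \<le> t\<close>] u]
    show "sdepth_quot n (J (n - 1) t) = 0" "depth_quot n (J (n - 1) t) = 0" by simp_all
  next
    fix t :: nat assume n: "3 \<le> n \<and> odd n" and t: "(n - 1) div 2 \<le> t"
    have "n = 2 * ((n - 1) div 2) + 1" "3 \<le> n" using n by (auto elim!: oddE)
    from edge_power_socle[OF this t] obtain u where u: "u \<in> exponents {1..n} - ?A2 t"
      "\<forall>i\<in>{1..n}. u + Poly_Mapping.single i 1 \<in> ?A2 t" by (rule bexE)
    have "1 \<le> t" using t n by (auto elim!: oddE)
    from zero[OF loc2[OF this \<open>3 \<le> n\<close>] u]
    show "sdepth_quot n (J (n - 2) t) = 0" "depth_quot n (J (n - 2) t) = 0" by simp_all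
  next
    fix t :: nat assume n: "5 \<le> n \<and> odd n" and t: "1 \<le> t \<and> t < (n - 1) div 2"
    then have "0 < sdepth_quot n (J (n - 2) t) \<and> 1 \<le> depth_quot n (J (n - 2) t)"
      by (intro pos) auto
    then show "0 < sdepth_quot n (J (n - 2) t)" "0 < depth_quot n (J (n - 2) t)"
      by (auto intro: less_le_trans[of 0 1])
  next
    fix t :: nat assume n: "5 \<le> n \<and> even n" and t: "1 \<le> t"
    then have "0 < sdepth_quot n (J (n - 2) t) \<and> 1 \<le> depth_quot n (J (n - 2) t)"
      by (intro pos) auto
    then show "0 < sdepth_quot n (J (n - 2) t)" "0 < depth_quot n (J (n - 2) t)"
      by (auto intro: less_le_trans[of 0 1])
  next
    fix t :: nat assume n: "5 \<le> n \<and> even n" and t: "n - 1 \<le> t"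
    then have p: "0 < sdepth_quot n (J (n - 2) t) \<and> 1 \<le> depth_quot n (J (n - 2) t)"
      by (intro pos) auto
    have q: "sdepth_quot n (J (n - 2) t) \<le> n div 2 \<and> depth_quot n (J (n - 2) t) \<le> 1"
      using n t by (intro top) auto
    from p q show d: "depth_quot n (J (n - 2) t) = 1" by (auto intro: antisym)
    from q show "sdepth_quot n (J (n - 2) t) \<le> n div 2" by blast
    \<comment> \<open>The depth is 1, so positivity of the Stanley depth is enough.\<close>
    from p show "depth_quot n (J (n - 2) t) \<le> enat (sdepth_quot n (J (n - 2) t))"
      by (simp add: d one_enat_def)
  qed
qed

end
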